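(* Let $\alpha,b,x_1,\dots,x_n,a_1,\dots,a_n$ be complex parameters such that no denominator in the identity below vanishes. Let $f(y)$ be a complex function of one variable (defined at all points where it is evaluated below). Assume that either (i) $f$ is such that both sides of the identity are analytic in $a_1,\dots,a_n$ and the series converges absolutely for each $a_r$ in a disk around the origin, and each $a_r$ lies in this disk; or (ii) $a_r=q^{N_r}$ with $N_r$ a positive integer for $r=1,\dots,n$ (so that the series terminates). Then $$\begin{aligned} & f(\alpha a_{1}\cdots a_{n}q^{1-n})\frac{(\alpha q,\alpha a_{1}\cdots a_{n}b/q^{n})_{\infty}}{(\alpha a_{1}\cdots a_{n}q^{1-n},\alpha b)_{\infty}}\\ &=\sum_{k_1,\dots,k_n\ge0}\ \prod_{1\leq r<s\leq n}\frac{1-q^{k_{r}-k_{s}}x_{r}/x_{s}}{1-x_{r}/x_{s}}\prod_{r,s=1}^{n}\frac{(qx_{r}/(x_{s}a_{s}))_{k_{r}}}{(qx_{r}/x_{s})_{k_{r}}}\\ &\quad\times\frac{(1-\alpha q^{2|\boldsymbol{k}|})(\alpha)_{|\boldsymbol{k}|}}{(1-\alpha)(\alpha a_{1}\cdots a_{n}q^{1-n})_{|\boldsymbol{k}|}}(a_{1}\cdots a_{n})^{|\boldsymbol{k}|}q^{\sum_{r=1}^{n}(r-1)k_{r}-n|\boldsymbol{k}|}\\ &\quad\times\sum_{\substack{0\leq m_{r}\leq k_{r}\\ r=1,\dots,n}}\ \prod_{1\leq r<s\leq n}\frac{1-q^{m_{r}-m_{s}}x_{r}/x_{s}}{1-x_{r}/x_{s}}\prod_{r,s=1}^{n}\frac{(q^{-k_{s}}x_{r}/x_{s})_{m_{r}}}{(qx_{r}/x_{s})_{m_{r}}}\cdot\frac{(\alpha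 q^{|\boldsymbol{k}|})_{|\boldsymbol{m}|}}{(\alpha b)_{|\boldsymbol{m}|}}q^{\sum_{r=1}^{n}rm_{r}}f(\alpha q^{1+|\boldsymbol{m}|}). \end{aligned}$$
   Context: $q$ is a complex number with $0<|q|<1$ and $n\ge1$ is an integer. $(z)_\infty=\prod_{i\ge0}(1-zq^i)$ and $(z)_k=(z)_\infty/(zq^k)_\infty=\prod_{i=0}^{k-1}(1-zq^i)$; $(c_1,\dots,c_p)_k=(c_1)_k\cdots(c_p)_k$ for $k$ a nonnegative integer or $\infty$. Bold letters denote multi-indices of nonnegative integers, $\boldsymbol k=(k_1,\dots,k_n)$, with $|\boldsymbol k|=k_1+\cdots+k_n$. If some $a_s=0$, the expression $\prod_{r,s}(qx_r/(x_sa_s))_{k_r}(a_1\cdots a_n)^{|\boldsymbol k|}$, which is polynomial in the $a_s$, is understood by continuity. *)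

theory Defs
  imports "HOL-Analysis.Analysis"
begin

definition qpoch :: "complex \<Rightarrow> complex \<Rightarrow> nat \<Rightarrow> complex" where
  "qpoch q z k = (\<Prod>i<k. 1 - z * q ^ i)"

definition qpoch_inf :: "complex \<Rightarrow> complex \<Rightarrow> complex" where
  "qpoch_inf q z = (\<Prod>i. 1 - z * q ^ i)"

text \<open>Vectors and multi-indices are functions on the naturals of which only the entries with
  index in \<open>{1..n}\<close> matter; multi-indices are made unique by extensionality.\<close>

definition multi_indices :: "nat \<Rightarrow> (nat \<Rightarrow> nat) set" where
  "multi_indices n = (\<Pi>\<^sub>E r\<in>{1..n}. UNIV)"

definition multi_le :: "nat \<Rightarrow> (nat \<Rightarrow> nat) \<Rightarrow> (nat \<Rightarrow> nat) set" where
  "multi_le n k = (\<Pi>\<^sub>E r\<in>{1..n}. {0..k r})"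

definition msize :: "nat \<Rightarrow> (nat \<Rightarrow> nat) \<Rightarrow> nat" where
  "msize n k = (\<Sum>r=1..n. k r)"

definition vprod :: "nat \<Rightarrow> (nat \<Rightarrow> complex) \<Rightarrow> complex" where
  "vprod n a = (\<Prod>r=1..n. a r)"

definition vandermonde_quot :: "complex \<Rightarrow> nat \<Rightarrow> (nat \<Rightarrow> complex) \<Rightarrow> (nat \<Rightarrow> nat) \<Rightarrow> complex" where
  "vandermonde_quot q n x k =
     (\<Prod>s=1..n. \<Prod>r\<in>{1..<s}.
        (1 - q powi (int (k r) - int (k s)) * x r / x s) / (1 - x r / x s))"

text \<open>The product \<open>\<Prod>\<^sub>r\<^sub>,\<^sub>s (q x\<^sub>r / (x\<^sub>s a\<^sub>s))\<^bsub>k\<^sub>r\<^esub> \<cdot> (a\<^sub>1 \<cdots> a\<^sub>n)\<^bsup>|k|\<^esup>\<close>, first as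
  displayed, and then extended by continuity to points where some \<open>a\<^sub>s\<close> vanishes. The lemmas
  \<open>numer_eq_poly\<close> and \<open>continuous_on_numer\<close> below confirm that the limit is the expected one.\<close>

definition numer_generic ::
  "complex \<Rightarrow> nat \<Rightarrow> (nat \<Rightarrow> complex) \<Rightarrow> (nat \<Rightarrow> nat) \<Rightarrow> (nat \<Rightarrow> complex) \<Rightarrow> complex" where
  "numer_generic q n x k a =
     (\<Prod>r=1..n. \<Prod>s=1..n. qpoch q (q * x r / (x s * a s)) (k r)) * vprod n a ^ msize n k"

definition numer ::
  "complex \<Rightarrow> nat \<Rightarrow> (nat \<Rightarrow> complex) \<Rightarrow> (nat \<Rightarrow> nat) \<Rightarrow> (nat \<Rightarrow> complex) \<Rightarrow> complex" where
  "numer q n x k a =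
     (if \<forall>s\<in>{1..n}. a s \<noteq> 0 then numer_generic q n x k a
      else Lim (at a within {a'. \<forall>s\<in>{1..n}. a' s \<noteq> 0}) (numer_generic q n x k))"

definition numer_poly ::
  "complex \<Rightarrow> nat \<Rightarrow> (nat \<Rightarrow> complex) \<Rightarrow> (nat \<Rightarrow> nat) \<Rightarrow> (nat \<Rightarrow> complex) \<Rightarrow> complex" where
  "numer_poly q n x k a =
     (\<Prod>r=1..n. \<Prod>s=1..n. \<Prod>i<k r. a s - q * x r / x s * q ^ i)"

lemma numer_generic_eq_poly:
  assumes "\<forall>s\<in>{1..n}. a s \<noteq> 0"
  shows "numer_generic q n x k a = numer_poly q n x k a"
proof -
  have "vprod n a ^ msize n k = (\<Prod>r=1..n. \<Prod>s=1..n. a s ^ k r)"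
    by (simp add: vprod_def msize_def power_sum prod_power_distrib)
  then have "numer_generic q n x k a =
      (\<Prod>r=1..n. \<Prod>s=1..n. qpoch q (q * x r / (x s * a s)) (k r) * a s ^ k r)"
    by (simp add: numer_generic_def prod.distrib)
  also have "\<dots> = numer_poly q n x k a"
    unfolding numer_poly_def
  proof (intro prod.cong refl)
    fix r s assume "s \<in> {1..n}"
    with assms have "a s \<noteq> 0" by blast
    have "qpoch q (q * x r / (x s * a s)) (k r) * a s ^ k r
        = (\<Prod>i<k r. (1 - q * x r / (x s * a s) * q ^ i) * a s)"
      by (simp add: qpoch_def prod.distrib)
    also have "\<dots> = (\<Prod>i<k r. a s - q * x r / x s * q ^ i)"
      using \<open>a s \<noteq> 0\<close> by (intro prod.cong refl) (simp add: field_simps)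
    finally show "qpoch q (q * x r / (x s * a s)) (k r) * a s ^ k r
        = (\<Prod>i<k r. a s - q * x r / x s * q ^ i)" .
  qed
  finally show ?thesis .
qed

lemma continuous_on_numer_poly: "continuous_on A (numer_poly q n x k)"
proof -
  have "continuous_on A (\<lambda>a. a s :: complex)" for s :: nat
    by (rule continuous_on_subset[OF continuous_on_product_coordinates]) simp
  then show ?thesis
    unfolding numer_poly_def by (intro continuous_intros)
qed

lemma numer_eq_poly: "numer q n x k a = numer_poly q n x k a"
proof (cases "\<forall>s\<in>{1..n}. a s \<noteq> 0")
  case True
  then show ?thesis by (simp add: numer_def numer_generic_eq_poly)
next
  case False
  define S where "S = {a' :: nat \<Rightarrow> complex. \<forall>s\<in>{1..n}. a' s \<noteq> 0}"
  define F where "F = at a within S"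
  have "isCont (numer_poly q n x k) a"
    using continuous_on_numer_poly[of UNIV] by (simp add: continuous_on_eq_continuous_at)
  then have "(numer_poly q n x k \<longlongrightarrow> numer_poly q n x k a) F"
    unfolding F_def isCont_def by (rule tendsto_within_subset) simp
  moreover have "\<forall>\<^sub>F a' in F. numer_poly q n x k a' = numer_generic q n x k a'"
    unfolding F_def eventually_at_topological S_def
    by (intro exI[of _ UNIV]) (auto simp: numer_generic_eq_poly)
  ultimately have lim: "(numer_generic q n x k \<longlongrightarrow> numer_poly q n x k a) F"
    by (rule Lim_transform_eventually)
  define X where "X = (\<lambda>(j::nat) s. if a s = 0 then inverse (of_nat (Suc j)) else a s)"
  have XS: "X j \<in> S - {a}" for j
  proof -
    obtain s where "s \<in> {1..n}" "a s = 0" using False by blast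
    then have "X j s \<noteq> a s" by (simp add: X_def del: of_nat_Suc)
    moreover have "X j \<in> S" by (auto simp: X_def S_def simp del: of_nat_Suc)
    ultimately show ?thesis by auto
  qed
  have "((\<lambda>j. X j s) \<longlongrightarrow> a s) sequentially" for s
    using LIMSEQ_inverse_real_of_nat[THEN tendsto_of_real, where 'a = complex]
    by (cases "a s = 0") (simp_all add: X_def)
  then have "((\<lambda>j. X j) \<longlongrightarrow> a) sequentially"
    using limitin_componentwise[of "\<lambda>_. euclidean" UNIV X a sequentially]
    by (simp add: euclidean_product_topology)
  then have "filterlim X F sequentially"
    unfolding F_def filterlim_at using XS by (auto intro: always_eventually)
  then have "F \<noteq> bot"
    by (metis filterlim_def filtermap_bot_iff le_bot sequentially_bot)
  then show ?thesis
    using tendsto_Lim[OF _ lim] False by (auto simp: numer_def F_def S_def)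
qed

lemma continuous_on_numer: "continuous_on A (numer q n x k)"
  using continuous_on_numer_poly[of A q n x k] by (simp add: numer_eq_poly[abs_def])

definition inner_sum ::
  "complex \<Rightarrow> nat \<Rightarrow> complex \<Rightarrow> complex \<Rightarrow> (nat \<Rightarrow> complex) \<Rightarrow> (complex \<Rightarrow> complex)
   \<Rightarrow> (nat \<Rightarrow> nat) \<Rightarrow> complex" where
  "inner_sum q n \<alpha> b x f k =
     (\<Sum>m\<in>multi_le n k.
        vandermonde_quot q n x m
        * (\<Prod>r=1..n. \<Prod>s=1..n.
             qpoch q (q powi (- int (k s)) * x r / x s) (m r) / qpoch q (q * x r / x s) (m r))
        * (qpoch q (\<alpha> * q ^ msize n k) (msize n m) / qpoch q (\<alpha> * b) (msize n m))
        * q ^ (\<Sum>r=1..n. r * m r)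
        * f (\<alpha> * q ^ (1 + msize n m)))"

definition series_term ::
  "complex \<Rightarrow> nat \<Rightarrow> complex \<Rightarrow> complex \<Rightarrow> (nat \<Rightarrow> complex) \<Rightarrow> (complex \<Rightarrow> complex)
   \<Rightarrow> (nat \<Rightarrow> complex) \<Rightarrow> (nat \<Rightarrow> nat) \<Rightarrow> complex" where
  "series_term q n \<alpha> b x f a k =
     vandermonde_quot q n x k
     * (numer q n x k a / (\<Prod>r=1..n. \<Prod>s=1..n. qpoch q (q * x r / x s) (k r)))
     * ((1 - \<alpha> * q ^ (2 * msize n k)) * qpoch q \<alpha> (msize n k)
        / ((1 - \<alpha>) * qpoch q (\<alpha> * vprod n a * q powi (1 - int n)) (msize n k)))
     * q powi ((\<Sum>r=1..n. (int r - 1) * int (k r)) - int n * int (msize n k))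
     * inner_sum q n \<alpha> b x f k"

definition lhs ::
  "complex \<Rightarrow> nat \<Rightarrow> complex \<Rightarrow> complex \<Rightarrow> (complex \<Rightarrow> complex) \<Rightarrow> (nat \<Rightarrow> complex) \<Rightarrow> complex" where
  "lhs q n \<alpha> b f a =
     f (\<alpha> * vprod n a * q powi (1 - int n))
     * (qpoch_inf q (\<alpha> * q) * qpoch_inf q (\<alpha> * vprod n a * b / q ^ n))
     / (qpoch_inf q (\<alpha> * vprod n a * q powi (1 - int n)) * qpoch_inf q (\<alpha> * b))"

definition polydisk :: "nat \<Rightarrow> real \<Rightarrow> (nat \<Rightarrow> complex) set" where
  "polydisk n R = {a. \<forall>r\<in>{1..n}. norm (a r) < R}"

text \<open>Analyticity in the \<open>n\<close> variables \<open>a\<^sub>1, \<dots>, a\<^sub>n\<close> jointly: an absolutely convergent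
  \<open>n\<close>-fold power series expansion around every point.\<close>

definition multi_analytic_on ::
  "nat \<Rightarrow> ((nat \<Rightarrow> complex) \<Rightarrow> complex) \<Rightarrow> (nat \<Rightarrow> complex) set \<Rightarrow> bool" where
  "multi_analytic_on n F S \<longleftrightarrow>
     (\<forall>p\<in>S. \<exists>e>0. \<exists>c :: (nat \<Rightarrow> nat) \<Rightarrow> complex. \<forall>a. (\<forall>r\<in>{1..n}. norm (a r - p r) < e) \<longrightarrow>
        ((\<lambda>k. c k * (\<Prod>r=1..n. (a r - p r) ^ k r)) has_sum F a) (multi_indices n))"

end

(*
  Since prod_{r<s} (1 - q^(k_r-k_s) x_r/x_s)/(1 - x_r/x_s) * q^(sum (r-1) k_r) is the quotient of the
  Vandermonde products of (x_r q^(k_r)) and (x_r), both the inner and the outer multiple sum can be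
  evaluated on each level |k| = K by Milne's fundamental theorem
    sum_{|k|=K} prod_{r<s} (x_r q^(k_r) - x_s q^(k_s))/(x_r - x_s)
        * prod_{r,s} (a_s x_r/x_s)_(k_r)/(q x_r/x_s)_(k_r)  =  (a_1...a_n)_K/(q)_K.
  This reduces the terminating case a_r = q^(N_r) to n = 1 with a = q^(1-n) a_1...a_n, which is
  Bailey's inversion: the coefficient of each value of f is a telescoping sum.
  In the analytic case both sides agree at all a_r = q^(N_r) with large N_r, and these points
  accumulate at the origin in each coordinate.
*)
theory Submission
  imports Defs "HOL-Complex_Analysis.Complex_Analysis"
begin

text \<open>The factor q^(1-n) comes from the outer numerators: their Milne parameters are q/a_s,
  with product q^n/(a_1...a_n) = q/a for a = q^(1-n) a_1...a_n. The inner sum has parameters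
  q^(-k_s), with product q^(-|k|), so its value depends on k only through |k|; this is what allows
  the outer sum to be grouped by levels as well. In the terminating case f is arbitrary, so the
  resulting one-variable identity must hold separately for the coefficient of each f(\<alpha>
  q^(1+m)). With a = q^(L+1) the coefficients for m < L vanish, and m = L belongs to the value of f
  on the left-hand side. In the analytic case the denominators (\<alpha> a_1...a_n q^(1-n))_k must
  be nonzero at the sample points too, which is why the N_r are taken large.\<close>

section \<open>Lagrange interpolation and Vandermonde products\<close>

text \<open>\<open>P\<close> and its Lagrange interpolant \<open>Q\<close> both have degree below
  \<open>card S\<close> and agree at the nodes, so they are equal. Every basis product
  \<open>l i\<close> is monic of degree \<open>card S - 1\<close>; the sum is the resulting top
  coefficient.\<close>

lemma lagrange_leading_coeff:
  fixes P :: "complex poly"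
  assumes fin: "finite S" and inj: "inj_on y S" and deg: "degree P < card S"
  shows "(\<Sum>i\<in>S. poly P (y i) / (\<Prod>j\<in>S-{i}. y i - y j)) = coeff P (card S - 1)"
proof -
  define l where "l i = (\<Prod>j\<in>S-{i}. [:- y j, 1:])" for i
  define c where "c i = poly P (y i) / (\<Prod>j\<in>S-{i}. y i - y j)" for i
  define Q where "Q = (\<Sum>i\<in>S. smult (c i) (l i))"
  have degl: "degree (l i) = card S - 1" and lead: "coeff (l i) (card S - 1) = 1"
    if "i \<in> S" for i
  proof -
    show d: "degree (l i) = card S - 1"
      unfolding l_def using fin that by (subst degree_prod_eq_sum_degree) auto
    have "lead_coeff (l i) = 1"
      unfolding l_def by (simp add: lead_coeff_prod)
    then show "coeff (l i) (card S - 1) = 1" using d by simp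
  qed
  have "P = Q"
  proof (rule poly_eqI_degree[of "y ` S"])
    fix z assume "z \<in> y ` S"
    then obtain i where i: "i \<in> S" "z = y i" by auto
    have "poly (smult (c j) (l j)) (y i) = (if j = i then poly P (y i) else 0)" if "j \<in> S" for j
    proof (cases "j = i")
      case True
      have "(\<Prod>k\<in>S-{i}. y i - y k) \<noteq> 0"
        using fin inj i by (auto simp: inj_on_def)
      then show ?thesis using True by (simp add: c_def l_def poly_prod)
    next
      case False
      then show ?thesis using i fin by (auto simp: l_def poly_prod)
    qed
    then have "poly Q (y i) = (\<Sum>j\<in>S. if j = i then poly P (y i) else 0)"
      unfolding Q_def poly_sum by (intro sum.cong refl) auto
    then show "poly P z = poly Q z" using i fin by simp
  next
    show "degree P < card (y ` S)" using deg inj by (simp add: card_image)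
    have "degree Q \<le> card S - 1"
      unfolding Q_def by (intro degree_sum_le fin order.trans[OF degree_smult_le]) (simp add: degl)
    then show "degree Q < card (y ` S)" using deg inj by (simp add: card_image)
  qed
  then have "coeff P (card S - 1) = (\<Sum>i\<in>S. c i * coeff (l i) (card S - 1))"
    by (simp add: Q_def coeff_sum)
  also have "\<dots> = (\<Sum>i\<in>S. c i)" by (intro sum.cong refl) (simp only: lead mult_1_right)
  finally show ?thesis by (simp add: c_def)
qed

text \<open>The interpolation nodes are the \<open>y i\<close> together with \<open>0\<close>.\<close>

lemma lagrange_prod_linear:
  fixes y c :: "nat \<Rightarrow> complex"
  assumes inj: "inj_on y {1..n}" and nz: "\<And>i. i \<in> {1..n} \<Longrightarrow> y i \<noteq> 0"
  shows "(\<Sum>i=1..n. (\<Prod>s=1..n. 1 - c s * y i) / (y i * (\<Prod>s\<in>{1..n}-{i}. y i - y s)))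
         = (-1)^n * ((\<Prod>s=1..n. c s) - 1 / (\<Prod>s=1..n. y s))"
proof -
  define Y where "Y i = (if i = 0 then 0 else y i)" for i :: nat
  define P where "P = (\<Prod>s=1..n. [:1, - c s:])"
  have Pv: "poly P z = (\<Prod>s=1..n. 1 - c s * z)" for z
    by (simp add: P_def poly_prod mult.commute)
  have injY: "inj_on Y {0..n}"
  proof (rule inj_onI)
    fix i j assume ij: "i \<in> {0..n}" "j \<in> {0..n}" "Y i = Y j"
    show "i = j"
    proof (cases "i = 0 \<or> j = 0")
      case True
      then show ?thesis using ij nz[of i] nz[of j] by (auto simp: Y_def split: if_splits)
    next
      case False
      then show ?thesis using ij by (intro inj_onD[OF inj]) (auto simp: Y_def)
    qed
  qed
  \<comment> \<open>Some \<open>c s\<close> may be 0, so the degree can drop; hence a degree bound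
    and the n-th coefficient instead of a leading coefficient.\<close>
  have "degree P \<le> n \<and> coeff P n = (\<Prod>s=1..n. - c s)"
  proof -
    have "degree (\<Prod>s=1..m. [:1, - c s:]) \<le> m \<and> coeff (\<Prod>s=1..m. [:1, - c s:]) m = (\<Prod>s=1..m. - c s)" for m
    proof (induction m)
      case (Suc m)
      define p where "p = (\<Prod>s=1..m. [:1, - c s:])"
      have p: "degree p \<le> m" "coeff p m = (\<Prod>s=1..m. - c s)" using Suc by (auto simp: p_def)
      have e: "(\<Prod>s=1..Suc m. [:1, - c s:]) = [:1, - c (Suc m):] * p"
        by (simp add: p_def mult.commute)
      have z: "coeff p (Suc m) = 0" using p by (simp add: coeff_eq_0)
      have "degree ([:1, - c (Suc m):] * p) \<le> Suc m"
        by (rule order.trans[OF degree_mult_le]) (use p in auto)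
      moreover have "coeff ([:1, - c (Suc m):] * p) (Suc m) = - c (Suc m) * coeff p m"
        using z by simp
      ultimately show ?case unfolding e using p by simp
    qed auto
    then show ?thesis by (simp add: P_def)
  qed
  then have degP: "degree P \<le> n" and cP: "coeff P n = (\<Prod>s=1..n. - c s)" by auto
  have "(\<Sum>i=0..n. poly P (Y i) / (\<Prod>j\<in>{0..n}-{i}. Y i - Y j)) = coeff P n"
    using lagrange_leading_coeff[OF _ injY, of P] degP by simp
  also have "(\<Sum>i=0..n. poly P (Y i) / (\<Prod>j\<in>{0..n}-{i}. Y i - Y j))
     = poly P (Y 0) / (\<Prod>j\<in>{0..n}-{0}. Y 0 - Y j)
       + (\<Sum>i=1..n. poly P (Y i) / (\<Prod>j\<in>{0..n}-{i}. Y i - Y j))"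
    by (simp add: sum.atLeast_Suc_atMost)
  also have "{0..n} - {0} = {1..n}" by auto
  also have "poly P (Y 0) / (\<Prod>j=1..n. Y 0 - Y j) = (-1)^n / (\<Prod>s=1..n. y s)"
  proof -
    have "(\<Prod>j=1..n. Y 0 - Y j) = (\<Prod>j=1..n. (-1) * y j)"
      by (intro prod.cong) (auto simp: Y_def)
    also have "\<dots> = (-1)^n * (\<Prod>s=1..n. y s)" by (simp only: prod.distrib) simp
    finally have *: "(\<Prod>j=1..n. Y 0 - Y j) = (-1)^n * (\<Prod>s=1..n. y s)" .
    have "poly P (Y 0) = 1" unfolding Pv by (simp add: Y_def)
    then show ?thesis unfolding * by (cases "even n") simp_all
  qed
  also have "(\<Sum>i=1..n. poly P (Y i) / (\<Prod>j\<in>{0..n}-{i}. Y i - Y j))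
      = (\<Sum>i=1..n. (\<Prod>s=1..n. 1 - c s * y i) / (y i * (\<Prod>s\<in>{1..n}-{i}. y i - y s)))"
  proof (intro sum.cong refl)
    fix i assume i: "i \<in> {1..n}"
    then have "{0..n} - {i} = insert 0 ({1..n} - {i})" by auto
    then have "(\<Prod>j\<in>{0..n}-{i}. Y i - Y j) = (Y i - Y 0) * (\<Prod>j\<in>{1..n}-{i}. Y i - Y j)"
      by simp
    also have "(\<Prod>j\<in>{1..n}-{i}. Y i - Y j) = (\<Prod>s\<in>{1..n}-{i}. y i - y s)"
      using i by (intro prod.cong) (auto simp: Y_def)
    finally show "poly P (Y i) / (\<Prod>j\<in>{0..n}-{i}. Y i - Y j)
      = (\<Prod>s=1..n. 1 - c s * y i) / (y i * (\<Prod>s\<in>{1..n}-{i}. y i - y s))"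
      using i by (simp add: Y_def Pv)
  qed
  finally have "(-1)^n / (\<Prod>s=1..n. y s)
      + (\<Sum>i=1..n. (\<Prod>s=1..n. 1 - c s * y i) / (y i * (\<Prod>s\<in>{1..n}-{i}. y i - y s)))
      = (\<Prod>s=1..n. (-1) * c s)" by (simp add: cP)
  also have "\<dots> = (-1)^n * (\<Prod>s=1..n. c s)" by (simp only: prod.distrib) simp
  finally show ?thesis by (simp add: algebra_simps)
qed

definition vdm :: "nat \<Rightarrow> (nat \<Rightarrow> complex) \<Rightarrow> complex" where
  "vdm n y = (\<Prod>s=1..n. \<Prod>r\<in>{1..<s}. y r - y s)"

text \<open>Only pairs containing \<open>i\<close> change. For r < i the Vandermonde factor is the
  negative of the one in the other product, but the same signs occur on both sides.\<close>

lemma vdm_update: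
  assumes "i \<in> {1..n}"
  shows "vdm n (y(i := z)) * (\<Prod>s\<in>{1..n}-{i}. y i - y s) = vdm n y * (\<Prod>s\<in>{1..n}-{i}. z - y s)"
  using assms
proof (induction n)
  case (Suc n)
  have step: "vdm (Suc n) u = vdm n u * (\<Prod>r=1..n. u r - u (Suc n))" for u
    by (simp add: vdm_def atLeastLessThanSuc_atLeastAtMost)
  show ?case
  proof (cases "i = Suc n")
    case True
    have S: "{1..Suc n} - {i} = {1..n}" using True by auto
    have v: "vdm n (y(i := z)) = vdm n y"
      unfolding vdm_def using True by (intro prod.cong refl) auto
    have p1: "(\<Prod>r=1..n. (y(i := z)) r - (y(i := z)) (Suc n)) = (\<Prod>r=1..n. (-1) * (z - y r))"
      using True by (intro prod.cong refl) auto
    have p2: "(\<Prod>r=1..n. y r - y (Suc n)) = (\<Prod>r=1..n. (-1) * (y i - y r))"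
      using True by (intro prod.cong refl) auto
    show ?thesis unfolding step S v p1 p2 prod.distrib by (simp only: mult_ac)
  next
    case False
    then have i: "i \<in> {1..n}" using Suc.prems by auto
    have S: "{1..Suc n} - {i} = insert (Suc n) ({1..n} - {i})" using False by auto
    have sp: "(\<Prod>r=1..n. u r - u (Suc n)) = (u i - u (Suc n)) * (\<Prod>r\<in>{1..n}-{i}. u r - u (Suc n))"
      for u :: "nat \<Rightarrow> complex"
      using i by (subst prod.remove[of _ i]) auto
    have p: "(\<Prod>r\<in>{1..n}-{i}. (y(i := z)) r - (y(i := z)) (Suc n))
        = (\<Prod>r\<in>{1..n}-{i}. y r - y (Suc n))"
      using False by (intro prod.cong refl) auto
    have I: "(\<Prod>s\<in>insert (Suc n) ({1..n} - {i}). g s) = g (Suc n) * (\<Prod>s\<in>{1..n} - {i}. g s)"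
      for g :: "nat \<Rightarrow> complex"
      by simp
    have u: "(y(i := z)) i = z" "(y(i := z)) (Suc n) = y (Suc n)" using False by auto
    have "vdm (Suc n) (y(i := z)) * (\<Prod>s\<in>{1..Suc n}-{i}. y i - y s)
       = (vdm n (y(i := z)) * (\<Prod>s\<in>{1..n}-{i}. y i - y s)) * (z - y (Suc n))
          * (\<Prod>r\<in>{1..n}-{i}. y r - y (Suc n)) * (y i - y (Suc n))"
      unfolding step S I sp[of y] sp[of "y(i := z)"] unfolding p unfolding u by (simp only: mult_ac)
    also have "\<dots> = vdm (Suc n) y * (\<Prod>s\<in>{1..Suc n}-{i}. z - y s)"
      unfolding Suc.IH[OF i] step S I sp[of y] by (simp only: mult_ac)
    finally show ?thesis .
  qed
qed simp

section \<open>Milne's fundamental theorem\<close>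

definition mterm :: "complex \<Rightarrow> nat \<Rightarrow> (nat \<Rightarrow> complex) \<Rightarrow> (nat \<Rightarrow> complex) \<Rightarrow> (nat \<Rightarrow> nat) \<Rightarrow> complex" where
  "mterm q n x a k = vdm n (\<lambda>r. x r * q ^ k r) / vdm n x *
     (\<Prod>r=1..n. \<Prod>s=1..n. qpoch q (a s * x r / x s) (k r) / qpoch q (q * x r / x s) (k r))"

definition level :: "nat \<Rightarrow> nat \<Rightarrow> (nat \<Rightarrow> nat) set" where
  "level n K = {k \<in> multi_indices n. msize n k = K}"

lemma finite_level: "finite (level n K)"
proof (rule finite_subset)
  show "level n K \<subseteq> (\<Pi>\<^sub>E r\<in>{1..n}. {0..K})"
    by (auto simp: level_def multi_indices_def msize_def PiE_def intro!: member_le_sum)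
qed (auto intro: finite_PiE)

lemma level_0: "level n 0 = {\<lambda>r\<in>{1..n}. 0}"
  by (auto simp: level_def multi_indices_def msize_def PiE_def extensional_def fun_eq_iff)

lemma qpoch_Suc: "qpoch q z (Suc k) = qpoch q z k * (1 - z * q ^ k)"
  by (simp add: qpoch_def)

lemma qpoch_0 [simp]: "qpoch q z 0 = 1"
  by (simp add: qpoch_def)

lemma msize_update:
  assumes "i \<in> {1..n}"
  shows "msize n (k(i := Suc (k i))) = Suc (msize n k)"
proof -
  have "msize n u = u i + (\<Sum>r\<in>{1..n}-{i}. u r)" for u
    unfolding msize_def using assms by (subst sum.remove[of _ i]) auto
  from this[of k] this[of "k(i := Suc (k i))"] show ?thesis
    by simp
qed

text \<open>Raising the i-th entry by one maps level \<open>K\<close> bijectively onto the part of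
  level \<open>Suc K\<close> with \<open>k i > 0\<close>, and \<open>g\<close> vanishes on the
  rest.\<close>

lemma sum_level_Suc:
  fixes g :: "(nat \<Rightarrow> nat) \<Rightarrow> complex"
  assumes i: "i \<in> {1..n}" and g0: "\<And>k. k i = 0 \<Longrightarrow> g k = 0"
  shows "(\<Sum>k\<in>level n (Suc K). g k) = (\<Sum>k\<in>level n K. g (k(i := Suc (k i))))"
proof -
  have "(\<Sum>k\<in>level n (Suc K). g k) = (\<Sum>k\<in>{k\<in>level n (Suc K). k i > 0}. g k)"
    using finite_level g0 by (intro sum.mono_neutral_right) auto
  also have "\<dots> = (\<Sum>k\<in>level n K. g (k(i := Suc (k i))))"
  proof (rule sum.reindex_bij_witness[where i = "\<lambda>k. k(i := Suc (k i))" and j = "\<lambda>k. k(i := k i - 1)"])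
    fix k assume "k \<in> {k\<in>level n (Suc K). k i > 0}"
    then have k: "k \<in> level n (Suc K)" "k i > 0" by auto
    have e: "(k(i := k i - 1))(i := Suc ((k(i := k i - 1)) i)) = k" using k by auto
    then show "(k(i := k i - 1))(i := Suc ((k(i := k i - 1)) i)) = k" .
    have "Suc (msize n (k(i := k i - 1))) = msize n k"
      using msize_update[OF i, of "k(i := k i - 1)"] e by simp
    then show "k(i := k i - 1) \<in> level n K"
      using k i by (auto simp: level_def multi_indices_def PiE_def extensional_def)
    show "g ((k(i := k i - 1))(i := Suc ((k(i := k i - 1)) i))) = g k" using e by simp
  next
    fix k assume "k \<in> level n K"
    then show "k(i := Suc (k i)) \<in> {k\<in>level n (Suc K). k i > 0}"
      using i msize_update[OF i, of k]
      by (auto simp: level_def multi_indices_def PiE_def extensional_def)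
  qed auto
  finally show ?thesis .
qed

text \<open>The cancellation in the recursion below: \<open>v / w\<close> is the Vandermonde
  quotient, \<open>V' / V\<close> its change when one node is multiplied by q, \<open>t\<close> the
  Pochhammer row of that node, \<open>A / B\<close> the change of this row, and \<open>R\<close> the
  product of the other rows.\<close>

lemma milne_step_algebra:
  fixes B V' :: complex
  assumes "B \<noteq> 0" "V' \<noteq> 0"
  shows "(v * V' / V) / w * (t * A / B * R) * (B / (q * y * V')) = v / w * (t * R) * (A / (y * V)) / q"
  using assms by (simp add: mult_ac)

text \<open>Milne's fundamental theorem. Lagrange interpolation turns \<open>1 - q\<^bsup>-|k|\<^esup>\<close> into a sum over
  the coordinates \<open>i\<close> of \<open>k\<close>, whose \<open>i\<close>-th summand relates \<open>k\<close> to \<open>k - e\<^sub>i\<close>.\<close>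

lemma milne_fundamental:
  fixes q :: complex and x a :: "nat \<Rightarrow> complex"
  assumes q0: "q \<noteq> 0" and q1: "\<And>j. j > 0 \<Longrightarrow> q ^ j \<noteq> 1"
    and x0: "\<And>s. s \<in> {1..n} \<Longrightarrow> x s \<noteq> 0"
    and xx: "\<And>r s. r \<in> {1..n} \<Longrightarrow> s \<in> {1..n} \<Longrightarrow> r \<noteq> s \<Longrightarrow> x r \<noteq> x s"
    and den: "\<And>r s k. r \<in> {1..n} \<Longrightarrow> s \<in> {1..n} \<Longrightarrow> qpoch q (q * x r / x s) k \<noteq> 0"
  shows "(\<Sum>k\<in>level n K. mterm q n x a k) = qpoch q (vprod n a) K / qpoch q q K"
proof -
  \<comment> \<open>Distinctness of the interpolation nodes: for different exponents, equality would
    make a factor of some (q x_r/x_s)_k vanish.\<close>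
  have shift: "x r * q ^ i \<noteq> x s * q ^ j" if rs: "r \<in> {1..n}" "s \<in> {1..n}" "r \<noteq> s" for r s i j
  proof -
    have pos: "x r * q ^ Suc d \<noteq> x s" if rs: "r \<in> {1..n}" "s \<in> {1..n}" for r s d
    proof
      assume "x r * q ^ Suc d = x s"
      then have "1 - q * x r / x s * q ^ d = 0"
        using x0[OF rs(2)] by (simp add: field_simps)
      then have "qpoch q (q * x r / x s) (Suc d) = 0" by (simp add: qpoch_Suc)
      with den[OF rs] show False by blast
    qed
    consider d where "i = j + Suc d" | d where "j = i + Suc d" | "i = j"
      by (metis add_Suc_right less_imp_Suc_add linorder_neqE_nat)
    then show ?thesis
    proof cases
      case 1
      then have "x r * q ^ i = x r * q ^ Suc d * q ^ j" by (simp add: power_add)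
      then show ?thesis using pos[OF rs(1,2), of d] q0 by (metis mult_right_cancel power_not_zero)
    next
      case 2
      then have "x s * q ^ j = x s * q ^ Suc d * q ^ i" by (simp add: power_add)
      then show ?thesis using pos[OF rs(2,1), of d] q0 by (metis mult_right_cancel power_not_zero)
    next
      case 3 then show ?thesis using xx rs q0 by auto
    qed
  qed
  define y where "y k = (\<lambda>r. x r * q ^ k r)" for k
  have injy: "inj_on (y k) {1..n}" for k
    unfolding inj_on_def y_def using shift by blast
  have y0: "y k i \<noteq> 0" if "i \<in> {1..n}" for k i using x0[OF that] q0 by (simp add: y_def)
  define X where "X = (\<Prod>s=1..n. x s)"
  have X0: "X \<noteq> 0" using x0 by (simp add: X_def)
  have vx: "vdm n x \<noteq> 0" using xx by (auto simp: vdm_def)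
  have prody: "(\<Prod>s=1..n. y k s) = X * q ^ msize n k" for k
    by (simp add: y_def prod.distrib X_def msize_def power_sum)
  \<comment> \<open>The summand of \<open>lagrange_prod_linear\<close> at the nodes
    \<open>y k\<close> with coefficients \<open>c s / x s\<close>. The choice c = 1 serves for level
    K+1, the choice c = a for level K.\<close>
  define E where "E c k i = (\<Prod>s=1..n. 1 - c s / x s * y k i) / (y k i * (\<Prod>s\<in>{1..n}-{i}. y k i - y k s))"
    for c :: "nat \<Rightarrow> complex" and k i
  have sumE: "(\<Sum>i=1..n. E c k i) = (-1)^n * (vprod n c - 1 / q ^ msize n k) / X" for c k
  proof -
    have "(\<Sum>i=1..n. E c k i) = (-1)^n * ((\<Prod>s=1..n. c s / x s) - 1 / (\<Prod>s=1..n. y k s))"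
      unfolding E_def by (rule lagrange_prod_linear[OF injy y0])
    also have "(\<Prod>s=1..n. c s / x s) = vprod n c / X"
      by (simp add: prod_dividef vprod_def X_def)
    finally show ?thesis using X0 unfolding prody by (simp add: algebra_simps diff_divide_distrib)
  qed
  \<comment> \<open>Raising \<open>k i\<close> multiplies node i by q. The new factors of the
    Pochhammer row are the numerators of the two E-terms, and the change of the Vandermonde product
    is the ratio of their denominators.\<close>
  have rel: "mterm q n x a (k(i := Suc (k i))) * E (\<lambda>_. 1) (k(i := Suc (k i))) i
       = mterm q n x a k * E a k i / q" if i: "i \<in> {1..n}" for k i
  proof -
    define k' where "k' = k(i := Suc (k i))"
    have yk': "y k' = (y k)(i := q * y k i)"
      by (rule ext) (simp add: y_def k'_def)
    define T where "T = (\<lambda>k r. \<Prod>s=1..n. qpoch q (a s * x r / x s) (k r) / qpoch q (q * x r / x s) (k r))"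
    have mt: "mterm q n x a k = vdm n (y k) / vdm n x * (T k i * (\<Prod>r\<in>{1..n}-{i}. T k r))" for k
    proof -
      have "(\<Prod>r=1..n. T k r) = T k i * (\<Prod>r\<in>{1..n}-{i}. T k r)"
        using i by (intro prod.remove) auto
      then show ?thesis by (simp add: mterm_def T_def y_def)
    qed
    have Trest: "(\<Prod>r\<in>{1..n}-{i}. T k' r) = (\<Prod>r\<in>{1..n}-{i}. T k r)"
      by (intro prod.cong refl) (auto simp: T_def k'_def)
    define A where "A = (\<Prod>s=1..n. 1 - a s / x s * y k i)"
    define B where "B = (\<Prod>s=1..n. 1 - 1 / x s * y k' i)"
    have B0: "B \<noteq> 0"
    proof -
      note den' = den[OF i, of _ "Suc (k i)", unfolded qpoch_Suc mult_eq_0_iff de_Morgan_disj]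
      have "1 - 1 / x s * y k' i \<noteq> 0" if s: "s \<in> {1..n}" for s
        using den'[OF s] by (simp add: y_def k'_def mult_ac)
      then show ?thesis by (simp add: B_def)
    qed
    have Ti: "T k' i = T k i * A / B"
    proof -
      have "T k' i = (\<Prod>s=1..n. (qpoch q (a s * x i / x s) (k i) / qpoch q (q * x i / x s) (k i))
          * (1 - a s / x s * y k i) / (1 - 1 / x s * y k' i))"
        unfolding T_def by (intro prod.cong refl) (simp add: k'_def qpoch_Suc y_def mult_ac)
      also have "\<dots> = T k i * A / B"
        unfolding prod_dividef prod.distrib T_def A_def B_def by (rule refl)
      finally show ?thesis .
    qed
    define V where "V = (\<Prod>s\<in>{1..n}-{i}. y k i - y k s)"
    define V' where "V' = (\<Prod>s\<in>{1..n}-{i}. q * y k i - y k s)"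
    have dist: "y k i - y k s \<noteq> 0" if "s \<in> {1..n} - {i}" for s k
      using inj_onD[OF injy[of k], of i s] that i by auto
    have V0: "V \<noteq> 0" unfolding V_def using dist by (subst prod_zero_iff) auto
    have V'eq: "V' = (\<Prod>s\<in>{1..n}-{i}. y k' i - y k' s)"
      unfolding V'_def yk' by (intro prod.cong) auto
    have V'0: "V' \<noteq> 0" unfolding V'eq using dist[of _ k'] by (subst prod_zero_iff) auto
    have vd: "vdm n (y k') * V = vdm n (y k) * V'"
      unfolding yk' V_def V'_def by (rule vdm_update[OF i])
    then have vd': "vdm n (y k') = vdm n (y k) * V' / V" using V0 by (simp add: field_simps)
    have Ek': "E (\<lambda>_. 1) k' i = B / (q * y k i * V')"
      unfolding E_def V'eq[symmetric] B_def by (simp add: yk')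
    have Ek: "E a k i = A / (y k i * V)" by (simp add: E_def A_def V_def)
    have "mterm q n x a k' * E (\<lambda>_. 1) k' i = mterm q n x a k * E a k i / q"
      unfolding mt Trest Ti vd' Ek' Ek by (rule milne_step_algebra[OF B0 V'0])
    then show ?thesis by (simp add: k'_def)
  qed
  \<comment> \<open>The factor s = i is 1 - x i / x i. This vanishing is what
    \<open>sum_level_Suc\<close> asks for.\<close>
  have E0: "E (\<lambda>_. 1) k i = 0" if "i \<in> {1..n}" "k i = 0" for k i
  proof -
    have "(\<Prod>s=1..n. 1 - 1 / x s * y k i) = 0"
      using that x0[OF that(1)] by (intro prod_zero) (auto simp: y_def intro!: bexI[of _ i])
    then show ?thesis by (simp add: E_def)
  qed
  define M where "M = mterm q n x a"
  define SS where "SS K = (\<Sum>k\<in>level n K. M k)" for K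
  \<comment> \<open>On a level the sum of the E-terms is constant, by \<open>sumE\<close>:
    proportional to 1 - q^(-K-1) for c = 1 on level K+1, and to a_1...a_n - q^(-K) for c = a on
    level K. Applying \<open>rel\<close> coordinate by coordinate links the two.\<close>
  have rec: "SS (Suc K) * (1 - q ^ Suc K) = SS K * (1 - vprod n a * q ^ K)" for K
  proof -
    have v1: "vprod n (\<lambda>_. 1) = 1" by (simp add: vprod_def)
    have "SS (Suc K) * ((-1)^n * (1 - 1 / q ^ Suc K) / X)
        = (\<Sum>k\<in>level n (Suc K). M k * (\<Sum>i=1..n. E (\<lambda>_. 1) k i))"
      unfolding SS_def sum_distrib_right sumE v1
      by (intro sum.cong refl) (simp add: level_def)
    also have "\<dots> = (\<Sum>i=1..n. \<Sum>k\<in>level n (Suc K). M k * E (\<lambda>_. 1) k i)"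
      unfolding sum_distrib_left by (rule sum.swap)
    also have "\<dots> = (\<Sum>i=1..n. \<Sum>k\<in>level n K. M k * E a k i / q)"
    proof (rule sum.cong[OF refl])
      fix i assume i: "i \<in> {1..n}"
      have "(\<Sum>k\<in>level n (Suc K). M k * E (\<lambda>_. 1) k i)
        = (\<Sum>k\<in>level n K. M (k(i := Suc (k i))) * E (\<lambda>_. 1) (k(i := Suc (k i))) i)"
        by (rule sum_level_Suc[OF i]) (simp add: E0[OF i])
      then show "(\<Sum>k\<in>level n (Suc K). M k * E (\<lambda>_. 1) k i) = (\<Sum>k\<in>level n K. M k * E a k i / q)"
        by (simp only: M_def rel[OF i])
    qed
    also have "\<dots> = (\<Sum>k\<in>level n K. M k * (\<Sum>i=1..n. E a k i) / q)"
      by (subst sum.swap) (simp only: sum_distrib_left sum_divide_distrib)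
    also have "\<dots> = SS K * ((-1)^n * (vprod n a - 1 / q ^ K) / X / q)"
      unfolding SS_def sum_distrib_right sumE
      by (intro sum.cong refl) (simp add: level_def)
    finally have "((-1)^n / X) * (SS (Suc K) * ((1 - 1 / q ^ Suc K)))
        = ((-1)^n / X) * (SS K * ((vprod n a - 1 / q ^ K) / q))"
      by (simp add: mult_ac)
    then have "SS (Suc K) * ((1 - 1 / q ^ Suc K)) = SS K * ((vprod n a - 1 / q ^ K) / q)"
      using X0 by (subst (asm) mult_cancel_left) simp
    then have "SS (Suc K) * ((1 - 1 / q ^ Suc K) * q ^ Suc K)
        = SS K * ((vprod n a - 1 / q ^ K) / q * q ^ Suc K)"
      by (simp only: mult.assoc[symmetric])
    also have "(1 - 1 / q ^ Suc K) * q ^ Suc K = q ^ Suc K - 1"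
      using q0 by (simp only: left_diff_distrib) simp
    also have "(vprod n a - 1 / q ^ K) / q * q ^ Suc K = vprod n a * q ^ K - 1"
      using q0 by (simp add: left_diff_distrib diff_divide_distrib)
    finally have "SS (Suc K) * (q ^ Suc K - 1) = SS K * (vprod n a * q ^ K - 1)" .
    then show ?thesis by (simp add: algebra_simps)
  qed
  have "SS K = qpoch q (vprod n a) K / qpoch q q K"
  proof (induction K)
    case 0
    \<comment> \<open>The only multi-index of level 0 is \<open>undefined\<close> outside
      \<open>{1..n}\<close>, where \<open>vdm\<close> does not look.\<close>
    have "vdm n (\<lambda>r. x r * q ^ (if r \<in> {1..n} then 0 else undefined)) = vdm n x"
      unfolding vdm_def by (intro prod.cong refl) auto
    then show ?case using vx by (simp add: SS_def level_0 M_def mterm_def)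
  next
    case (Suc K)
    have "1 - q ^ Suc K \<noteq> 0" using q1[of "Suc K"] by simp
    then have "SS (Suc K) = SS K * (1 - vprod n a * q ^ K) / (1 - q ^ Suc K)"
      using rec[of K] by (simp add: field_simps)
    then show ?case by (simp add: Suc qpoch_Suc)
  qed
  then show ?thesis by (simp add: SS_def M_def)
qed

section \<open>Bailey's inversion in one variable\<close>

lemma qpoch_add: "qpoch q z (i + j) = qpoch q z i * qpoch q (z * q ^ i) j"
  by (induction j) (simp_all add: qpoch_Suc power_add mult_ac)

lemma qpoch_neg_power_eq_0:
  assumes "q \<noteq> 0" "L < k"
  shows "qpoch q (q powi (- int L)) k = 0"
proof -
  have "1 - q powi (- int L) * q ^ L = 0"
    using assms by (simp add: power_int_minus)
  then show ?thesis
    unfolding qpoch_def using assms(2) by (intro prod_zero) auto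
qed

text \<open>The powers of \<open>q\<close> are placed so that all exponents are natural numbers.\<close>

lemma qpoch_neg_power:
  assumes q0: "q \<noteq> 0" and "m \<le> k"
  shows "qpoch q (q powi (- int k)) m * q ^ (k * m) * qpoch q q (k - m)
    = (-1) ^ m * q ^ (m * (m - 1) div 2) * qpoch q q k"
  using assms(2)
proof (induction m)
  case (Suc m)
  have IH: "qpoch q (q powi (- int k)) m * q ^ (k * m) * qpoch q q (k - m)
    = (-1) ^ m * q ^ (m * (m - 1) div 2) * qpoch q q k"
    using Suc by simp
  obtain d where d: "k = m + Suc d" using Suc.prems by (metis add_Suc_right less_eqE plus_nat.simps(2))
  have km: "k - m = Suc (k - Suc m)" using Suc.prems by simp
  have a: "(1 - q powi (- int k) * q ^ m) * q ^ k = - (q ^ m) * (1 - q * q ^ (k - Suc m))"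
  proof -
    have "(1 - q powi (- int k) * q ^ m) * q ^ k = q ^ k - (q powi (- int k) * q ^ k) * q ^ m"
      by (simp add: algebra_simps)
    also have "q powi (- int k) * q ^ k = 1"
      using q0 by (simp add: power_int_minus)
    finally show ?thesis by (simp add: d power_add right_diff_distrib)
  qed
  have e: "Suc m * (Suc m - 1) div 2 = m * (m - 1) div 2 + m"
    by (cases m) (simp_all add: algebra_simps)
  have "qpoch q (q powi (- int k)) (Suc m) * q ^ (k * Suc m) * qpoch q q (k - Suc m)
      = qpoch q (q powi (- int k)) m * q ^ (k * m) * ((1 - q powi (- int k) * q ^ m) * q ^ k) * qpoch q q (k - Suc m)"
    by (simp add: qpoch_Suc power_add mult_ac)
  also have "\<dots> = - (q ^ m) * (qpoch q (q powi (- int k)) m * q ^ (k * m) * qpoch q q (k - m))"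
    unfolding a km qpoch_Suc by (simp add: mult_ac)
  also have "\<dots> = (-1) ^ Suc m * q ^ (Suc m * (Suc m - 1) div 2) * qpoch q q k"
    unfolding IH e by (simp add: power_add mult_ac)
  finally show ?case .
qed simp

text \<open>The orthogonality relation behind Bailey's inversion. For \<open>m < L\<close> the summand is
  \<open>(U (k+1) - U k) / (q\<^bsup>L-m\<^esup> - 1)\<close> with an explicit \<open>U\<close> vanishing at both ends.\<close>

lemma telescoping_sum:
  fixes q \<alpha> :: complex
  assumes q0: "q \<noteq> 0" and q1: "\<And>j. j > 0 \<Longrightarrow> q ^ j \<noteq> 1"
    and den: "\<And>k. qpoch q (\<alpha> * q ^ Suc L) k \<noteq> 0" and "m < L"
  shows "(\<Sum>k=m..L. qpoch q (q powi (- int L)) k * q ^ ((L - m) * k) * (1 - \<alpha> * q ^ (2 * k))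
      * qpoch q \<alpha> (k + m) / (qpoch q q (k - m) * qpoch q (\<alpha> * q ^ Suc L) k)) = 0"
proof -
  have qq: "qpoch q q k \<noteq> 0" for k
    unfolding qpoch_def using q1[of "Suc _"] by (subst prod_zero_iff) auto
  define T where "T k = qpoch q (q powi (- int L)) k * q ^ ((L - m) * k) * (1 - \<alpha> * q ^ (2 * k))
      * qpoch q \<alpha> (k + m) / (qpoch q q (k - m) * qpoch q (\<alpha> * q ^ Suc L) k)" for k
  \<comment> \<open>The separate value at k = m encodes 1/(q)_(-1) = 0; truncated subtraction would
    make this factor 1.\<close>
  define U where "U k = (if k = m then 0 else
      qpoch q (q powi (- int L)) k * q ^ ((L - m) * k) * qpoch q \<alpha> (k + m)
      / (qpoch q q (k - Suc m) * qpoch q (\<alpha> * q ^ Suc L) (k - 1)))" for k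
  have step: "U (Suc k) - U k = (q ^ (L - m) - 1) * T k" if "k \<in> {m..L}" for k
  proof -
    obtain e where e: "k = m + e" using \<open>k \<in> {m..L}\<close> by (auto simp: le_iff_add)
    obtain d where d: "L = m + d" using \<open>m < L\<close> by (auto simp: less_iff_Suc_add)
    define W where "W = qpoch q (q powi (- int L)) k * q ^ (d * k) * qpoch q \<alpha> (k + m)
      / (qpoch q q e * qpoch q (\<alpha> * q ^ Suc L) k)"
    have T: "T k = W * (1 - \<alpha> * q ^ (2 * k))" by (simp add: T_def W_def e d)
    have US: "U (Suc k) = W * ((1 - q powi (- int L) * q ^ k) * q ^ d * (1 - \<alpha> * q ^ (k + m)))"
      by (simp add: U_def W_def qpoch_Suc e d power_add mult_ac)
    have U: "U k = W * ((1 - q ^ e) * (1 - \<alpha> * q ^ (L + k)))"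
    proof (cases e)
      case 0
      then show ?thesis by (simp add: U_def e)
    next
      case (Suc e')
      have n0: "1 - q ^ e \<noteq> 0" using q1[of e] Suc by simp
      have n1: "1 - \<alpha> * q ^ (L + k) \<noteq> 0"
        using den[of k] by (simp add: e Suc qpoch_Suc power_add mult_ac)
      have E: "qpoch q q e = qpoch q q (k - Suc m) * (1 - q ^ e)"
        by (simp add: e Suc qpoch_Suc)
      have F: "qpoch q (\<alpha> * q ^ Suc L) k = qpoch q (\<alpha> * q ^ Suc L) (k - 1) * (1 - \<alpha> * q ^ (L + k))"
        by (simp add: e Suc qpoch_Suc power_add mult_ac)
      have km: "k \<noteq> m" "L - m = d" using e Suc d by auto
      show ?thesis unfolding U_def W_def E F km(2) using n0 n1 km(1) by simp
    qed
    \<comment> \<open>With the common factor \<open>W\<close> removed, telescoping is this identity.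
      Since L = m + d and k = m + e, q^(-L) q^(k+d) is q^e.\<close>
    have "(1 - q powi (- int L) * q ^ k) * q ^ d * (1 - \<alpha> * q ^ (k + m))
        - (1 - q ^ e) * (1 - \<alpha> * q ^ (L + k)) = (q ^ (L - m) - 1) * (1 - \<alpha> * q ^ (2 * k))"
    proof -
      have "q powi (- int L) * (q ^ k * q ^ d) = q ^ e * (q powi (- int L) * q ^ L)"
        by (simp add: d e power_add mult_ac)
      also have "q powi (- int L) * q ^ L = 1"
        using q0 by (simp add: power_int_minus)
      finally have c: "(1 - q powi (- int L) * q ^ k) * q ^ d = q ^ d - q ^ e"
        by (simp add: left_diff_distrib mult.assoc)
      have k2: "q ^ (2 * k) = q ^ k * q ^ k" by (simp add: mult_2 power_add)
      show ?thesis unfolding c k2 by (simp add: d e power_add algebra_simps)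
    qed
    then show ?thesis unfolding US U T right_diff_distrib[symmetric] by (simp add: mult_ac)
  qed
  have "(q ^ (L - m) - 1) * (\<Sum>k=m..L. T k) = (\<Sum>k=m..L. U (Suc k) - U k)"
    by (simp add: sum_distrib_left step)
  also have "\<dots> = U (Suc L) - U m"
    using \<open>m < L\<close> by (subst sum_Suc_diff) auto
  also have "\<dots> = 0"
    using qpoch_neg_power_eq_0[OF q0, of L "Suc L"] by (simp add: U_def)
  finally show ?thesis using q1[of "L - m"] \<open>m < L\<close> by (simp add: T_def)
qed

lemma qpoch_Suc_shift: "qpoch q z (Suc k) = (1 - z) * qpoch q (z * q) k"
  using qpoch_add[of q z 1 k] by (simp add: qpoch_Suc)

text \<open>The case \<open>n = 1\<close>, \<open>a = q\<^bsup>L+1\<^esup>\<close>, \<open>\<alpha>b\<close>-factors absorbed into \<open>g\<close>.\<close>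

lemma bailey_inversion:
  fixes q \<alpha> :: complex and g :: "nat \<Rightarrow> complex"
  assumes q0: "q \<noteq> 0" and q1: "\<And>j. j > 0 \<Longrightarrow> q ^ j \<noteq> 1" and al: "1 - \<alpha> \<noteq> 0"
    and den: "\<And>k. qpoch q (\<alpha> * q ^ Suc L) k \<noteq> 0"
  shows "(\<Sum>k=0..L. qpoch q (q powi (- int L)) k / qpoch q q k
        * ((1 - \<alpha> * q ^ (2 * k)) * qpoch q \<alpha> k / ((1 - \<alpha>) * qpoch q (\<alpha> * q ^ Suc L) k)) * q ^ (L * k)
        * (\<Sum>m=0..k. qpoch q (q powi (- int k)) m / qpoch q q m * qpoch q (\<alpha> * q ^ k) m * q ^ m * g m))
    = qpoch q (\<alpha> * q) L * g L"
proof -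
  have qq: "qpoch q q k \<noteq> 0" for k
    unfolding qpoch_def using q1[of "Suc _"] by (subst prod_zero_iff) auto
  define T where "T m k = qpoch q (q powi (- int L)) k * q ^ ((L - m) * k) * (1 - \<alpha> * q ^ (2 * k))
      * qpoch q \<alpha> (k + m) / (qpoch q q (k - m) * qpoch q (\<alpha> * q ^ Suc L) k)" for m k
  \<comment> \<open>All that is independent of k once (q^(-k))_m is rewritten by
    \<open>qpoch_neg_power\<close> and (\<alpha>)_k (\<alpha> q^k)_m is merged into
    (\<alpha>)_(k+m); what remains is the summand \<open>T m k\<close> of
    \<open>telescoping_sum\<close>.\<close>
  define c where "c m = (-1) ^ m * q ^ (m * (m - 1) div 2) * q ^ m / (qpoch q q m * (1 - \<alpha>))" for m
  have term_eq: "qpoch q (q powi (- int L)) k / qpoch q q k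
        * ((1 - \<alpha> * q ^ (2 * k)) * qpoch q \<alpha> k / ((1 - \<alpha>) * qpoch q (\<alpha> * q ^ Suc L) k)) * q ^ (L * k)
        * (qpoch q (q powi (- int k)) m / qpoch q q m * qpoch q (\<alpha> * q ^ k) m * q ^ m * g m)
      = c m * g m * T m k" if mk: "m \<le> k" "k \<le> L" for m k
  proof -
    have P: "qpoch q (q powi (- int k)) m
        = (-1) ^ m * q ^ (m * (m - 1) div 2) * qpoch q q k / (q ^ (k * m) * qpoch q q (k - m))"
      using qpoch_neg_power[OF q0 mk(1)] qq[of "k - m"] q0 by (simp add: eq_divide_eq mult_ac)
    obtain d where d: "L = m + d" using mk by (metis le_trans less_eqE)
    have Q: "q ^ (L * k) = q ^ (k * m) * q ^ ((L - m) * k)"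
      by (simp add: d algebra_simps power_add)
    have D: "qpoch q \<alpha> (k + m) = qpoch q \<alpha> k * qpoch q (\<alpha> * q ^ k) m" by (rule qpoch_add)
    show ?thesis
      unfolding P Q c_def T_def D using qq[of k] q0 by (simp add: mult_ac)
  qed
  have "(\<Sum>k=0..L. qpoch q (q powi (- int L)) k / qpoch q q k
        * ((1 - \<alpha> * q ^ (2 * k)) * qpoch q \<alpha> k / ((1 - \<alpha>) * qpoch q (\<alpha> * q ^ Suc L) k)) * q ^ (L * k)
        * (\<Sum>m=0..k. qpoch q (q powi (- int k)) m / qpoch q q m * qpoch q (\<alpha> * q ^ k) m * q ^ m * g m))
    = (\<Sum>k=0..L. \<Sum>m=0..k. c m * g m * T m k)"
    unfolding sum_distrib_left by (intro sum.cong refl) (rule term_eq; simp)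
  also have "\<dots> = (\<Sum>m=0..L. \<Sum>k=m..L. c m * g m * T m k)"
  proof -
    have "{0..k} = {m \<in> {0..L}. m \<le> k}" if "k \<in> {0..L}" for k using that by auto
    then have "(\<Sum>k=0..L. \<Sum>m=0..k. c m * g m * T m k)
        = (\<Sum>k=0..L. \<Sum>m\<in>{m \<in> {0..L}. m \<le> k}. c m * g m * T m k)"
      by (intro sum.cong) auto
    also have "\<dots> = (\<Sum>m=0..L. \<Sum>k\<in>{k \<in> {0..L}. m \<le> k}. c m * g m * T m k)"
      by (rule sum.swap_restrict) auto
    also have "\<dots> = (\<Sum>m=0..L. \<Sum>k=m..L. c m * g m * T m k)"
      by (intro sum.cong refl) auto
    finally show ?thesis .
  qed
  also have "\<dots> = (\<Sum>m=0..L. if m = L then c L * g L * T L L else 0)"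
  proof (intro sum.cong refl)
    fix m assume "m \<in> {0..L}"
    then consider "m < L" | "m = L" by fastforce
    then show "(\<Sum>k=m..L. c m * g m * T m k) = (if m = L then c L * g L * T L L else 0)"
    proof cases
      case 1
      then show ?thesis
        using telescoping_sum[OF q0 q1 den 1] unfolding T_def sum_distrib_left[symmetric] by simp
    qed simp
  qed
  also have "\<dots> = c L * g L * T L L" by simp
  also have "c L * g L * T L L = qpoch q (\<alpha> * q) L * g L"
  proof -
    have P: "qpoch q (q powi (- int L)) L * q ^ (L * L) = (-1) ^ L * q ^ (L * (L - 1) div 2) * qpoch q q L"
      using qpoch_neg_power[OF q0 order_refl, of L] by simp
    \<comment> \<open>One triangular exponent comes from \<open>c L\<close>, the other from
      (q^(-L))_L; together with q^L they cancel the power q^(L*L) in \<open>P\<close>.\<close>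
    have "L * (L - 1) div 2 + L * (L - 1) div 2 + L = L * L"
    proof -
      have "even (L * (L - 1))" by (cases L) auto
      then obtain e where "L * (L - 1) = 2 * e" by (elim evenE)
      then have "L * (L - 1) div 2 + L * (L - 1) div 2 = L * (L - 1)" by simp
      then show ?thesis by (cases L) auto
    qed
    then have E: "q ^ (L * (L - 1) div 2) * q ^ (L * (L - 1) div 2) * q ^ L = q ^ (L * L)"
      by (simp flip: power_add)
    have S: "((-1::complex) ^ L) * (-1) ^ L = 1" by (simp flip: power_mult_distrib)
    have "q ^ (L * L) * ((-1) ^ L * q ^ (L * (L - 1) div 2) * q ^ L * qpoch q (q powi (- int L)) L)
        = ((-1) ^ L * q ^ (L * (L - 1) div 2) * q ^ L) * (qpoch q (q powi (- int L)) L * q ^ (L * L))"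
      by (simp only: mult_ac)
    also have "\<dots> = (((-1) ^ L) * (-1) ^ L) * (q ^ (L * (L - 1) div 2) * q ^ (L * (L - 1) div 2) * q ^ L) * qpoch q q L"
      unfolding P by (simp only: mult_ac)
    also have "\<dots> = q ^ (L * L) * qpoch q q L"
      unfolding E S by simp
    finally have F: "(-1) ^ L * q ^ (L * (L - 1) div 2) * q ^ L * qpoch q (q powi (- int L)) L = qpoch q q L"
      using q0 by (subst (asm) mult_cancel_left) simp
    \<comment> \<open>The factor 1 - \<alpha> q^(2L) completes (\<alpha>)_(2L) to (\<alpha>)_(2L+1),
      which is split after its first factor and again after L more.\<close>
    have G: "qpoch q \<alpha> (L + L) * (1 - \<alpha> * q ^ (2 * L)) = (1 - \<alpha>) * (qpoch q (\<alpha> * q) L * qpoch q (\<alpha> * q ^ Suc L) L)"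
    proof -
      have "qpoch q \<alpha> (L + L) * (1 - \<alpha> * q ^ (2 * L)) = qpoch q \<alpha> (Suc (L + L))"
        by (simp add: qpoch_Suc mult_2)
      then show ?thesis
        unfolding qpoch_Suc_shift qpoch_add by (simp add: mult_ac)
    qed
    have "c L * g L * T L L = ((-1) ^ L * q ^ (L * (L - 1) div 2) * q ^ L * qpoch q (q powi (- int L)) L)
       * (qpoch q \<alpha> (L + L) * (1 - \<alpha> * q ^ (2 * L))) * g L / (qpoch q q L * (1 - \<alpha>) * qpoch q (\<alpha> * q ^ Suc L) L)"
      by (simp add: c_def T_def mult_ac)
    also have "\<dots> = qpoch q (\<alpha> * q) L * g L"
      unfolding F G using qq[of L] al den[of L] by simp
    finally show ?thesis .
  qed
  finally show ?thesis .
qed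

section \<open>Infinite q-products\<close>

lemma convergent_prod_qpoch_inf:
  assumes "norm q < 1"
  shows "convergent_prod (\<lambda>i. 1 - z * q ^ i :: complex)"
proof -
  have "summable (\<lambda>i. norm z * norm q ^ i)"
    using assms by (intro summable_mult summable_geometric) auto
  then have "abs_convergent_prod (\<lambda>i. 1 - z * q ^ i)"
    by (intro summable_imp_abs_convergent_prod) (simp add: norm_mult norm_power)
  then show ?thesis by (rule abs_convergent_prod_imp_convergent_prod)
qed

lemma qpoch_nonzero_imp_factor:
  assumes "\<And>k. qpoch q z k \<noteq> 0"
  shows "1 - z * q ^ i \<noteq> 0"
  using assms[of "Suc i"] by (auto simp: qpoch_Suc)

lemma qpoch_inf_nonzero:
  assumes "norm q < 1" "\<And>k. qpoch q z k \<noteq> 0"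
  shows "qpoch_inf q z \<noteq> 0"
  unfolding qpoch_inf_def
  by (rule prodinf_nonzero[OF convergent_prod_qpoch_inf[OF assms(1)] qpoch_nonzero_imp_factor[OF assms(2)]])

text \<open>If none of the first L factors vanishes, the infinite product can be cut after them;
  otherwise both sides are 0.\<close>

lemma qpoch_inf_split:
  assumes "norm q < 1"
  shows "qpoch_inf q z = qpoch q z L * qpoch_inf q (z * q ^ L)"
proof (cases "\<forall>i<L. 1 - z * q ^ i \<noteq> 0")
  case True
  have "qpoch_inf q z = (\<Prod>i. 1 - z * q ^ (i + L)) * (\<Prod>i<L. 1 - z * q ^ i)"
    unfolding qpoch_inf_def
    by (rule prodinf_split_initial_segment[OF convergent_prod_qpoch_inf[OF assms]]) (use True in auto)
  also have "(\<lambda>i. 1 - z * q ^ (i + L)) = (\<lambda>i. 1 - z * q ^ L * q ^ i)"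
    by (simp add: power_add mult_ac)
  finally show ?thesis by (simp add: qpoch_inf_def qpoch_def)
next
  case False
  then obtain i where i: "i < L" "1 - z * q ^ i = 0" by auto
  have "(\<Prod>i. 1 - z * q ^ i) = 0"
    using convergent_prod_has_prod[OF convergent_prod_qpoch_inf[OF assms, of z]] i(2)
    by (metis has_prod_zeroI)
  moreover have "qpoch q z L = 0"
    unfolding qpoch_def using i by (intro prod_zero) auto
  ultimately show ?thesis by (simp add: qpoch_inf_def)
qed

section \<open>Reduction of the multiple sums to one variable\<close>

lemma prod_power_left_index:
  fixes q :: complex
  shows "(\<Prod>s=1..n. \<Prod>r\<in>{1..<s}. q ^ k s) = q ^ (\<Sum>r=1..n. (r - 1) * k r)"
  by (simp add: power_sum power_mult mult.commute)

text \<open>Each pair r < s absorbs one factor q^(k_s), and s is the larger index of s - 1 pairs.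
  The denominators x_s and the reversed signs cancel.\<close>

lemma vandermonde_quot_eq_vdm:
  assumes q0: "q \<noteq> 0"
    and x0: "\<And>s. s \<in> {1..n} \<Longrightarrow> x s \<noteq> 0"
    and xx: "\<And>r s. r \<in> {1..n} \<Longrightarrow> s \<in> {1..n} \<Longrightarrow> r \<noteq> s \<Longrightarrow> x r \<noteq> x s"
  shows "vandermonde_quot q n x k * q ^ (\<Sum>r=1..n. (r - 1) * k r)
    = vdm n (\<lambda>r. x r * q ^ k r) / vdm n x"
  unfolding vandermonde_quot_def vdm_def prod_power_left_index[symmetric]
    prod.distrib[symmetric] prod_dividef[symmetric]
proof (intro prod.cong refl)
  fix s r assume s: "s \<in> {1..n}" and r: "r \<in> {1..<s}"
  have n: "x s \<noteq> 0" "x r \<noteq> x s" using x0[OF s] xx[of r s] r s by auto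
  have "(1 - q powi (int (k r) - int (k s)) * x r / x s) * q ^ k s = (x s * q ^ k s - x r * q ^ k r) / x s"
  proof -
    have "q powi (int (k r) - int (k s)) * q ^ k s = q ^ k r"
      using q0 by (simp add: power_int_diff)
    moreover have "(1 - q powi (int (k r) - int (k s)) * x r / x s) * q ^ k s
        = q ^ k s - (q powi (int (k r) - int (k s)) * q ^ k s) * x r / x s"
      by (simp add: algebra_simps)
    ultimately have "(1 - q powi (int (k r) - int (k s)) * x r / x s) * q ^ k s = q ^ k s - q ^ k r * x r / x s"
      by simp
    then show ?thesis using n(1) by (simp add: diff_divide_distrib mult_ac)
  qed
  moreover have "1 - x r / x s = (x s - x r) / x s" using n(1) by (simp add: diff_divide_distrib)
  moreover have "u / v * w = u * w / v" for u v w :: complex by simp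
  ultimately have "(1 - q powi (int (k r) - int (k s)) * x r / x s) / (1 - x r / x s) * q ^ k s
      = (x s * q ^ k s - x r * q ^ k r) / (x s - x r)"
    using n by (simp only:) simp
  also have "\<dots> = (- (x r * q ^ k r - x s * q ^ k s)) / (- (x r - x s))" by simp
  also have "\<dots> = (x r * q ^ k r - x s * q ^ k s) / (x r - x s)" by (simp only: minus_divide_divide)
  finally show "(1 - q powi (int (k r) - int (k s)) * x r / x s) / (1 - x r / x s) * q ^ k s
      = (x r * q ^ k r - x s * q ^ k s) / (x r - x s)" .
qed

lemma finite_msize_le: "finite {k \<in> multi_indices n. msize n k \<le> K}"
proof -
  have "{k \<in> multi_indices n. msize n k \<le> K} = (\<Union>j\<in>{0..K}. level n j)"
    by (auto simp: level_def)
  then show ?thesis using finite_level by simp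
qed

lemma sum_msize_le:
  fixes g :: "(nat \<Rightarrow> nat) \<Rightarrow> complex"
  shows "(\<Sum>k\<in>{k \<in> multi_indices n. msize n k \<le> K}. g k) = (\<Sum>j=0..K. \<Sum>k\<in>level n j. g k)"
proof -
  have "{k \<in> multi_indices n. msize n k \<le> K} = (\<Union>j\<in>{0..K}. level n j)"
    by (auto simp: level_def)
  then show ?thesis
    using finite_level by (simp only:) (subst sum.UNION_disjoint, auto simp: level_def)
qed

text \<open>In row r the factor with s = r has argument \<open>a r\<close>. This is how sums over
  boxes of multi-indices are extended to whole levels.\<close>

lemma mterm_eq_0:
  assumes "r \<in> {1..n}" "x r \<noteq> 0" "qpoch q (a r) (k r) = 0"
  shows "mterm q n x a k = 0"
proof -
  have "(\<Prod>s=1..n. qpoch q (a s * x r / x s) (k r) / qpoch q (q * x r / x s) (k r)) = 0"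
    by (rule prod_zero) (use assms in \<open>simp_all add: bexI[of _ r]\<close>)
  then have "(\<Prod>r=1..n. \<Prod>s=1..n. qpoch q (a s * x r / x s) (k r) / qpoch q (q * x r / x s) (k r)) = 0"
    using assms(1) by (intro prod_zero) (simp, blast)
  then show ?thesis by (simp add: mterm_def)
qed

text \<open>Milne's theorem with a_s = q^(-k_s). The box m \<le> k may be enlarged to |m| \<le> |k|,
  because outside the box some (q^(-k_r))_(m_r) is 0. The factor 1/(\<alpha> b)_m stays with f:
  together they form the arbitrary function of the inversion.\<close>

lemma inner_sum_eq:
  fixes q \<alpha> b :: complex and x :: "nat \<Rightarrow> complex"
  assumes q0: "q \<noteq> 0" and q1: "\<And>j. j > 0 \<Longrightarrow> q ^ j \<noteq> 1"
    and x0: "\<And>s. s \<in> {1..n} \<Longrightarrow> x s \<noteq> 0"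
    and xx: "\<And>r s. r \<in> {1..n} \<Longrightarrow> s \<in> {1..n} \<Longrightarrow> r \<noteq> s \<Longrightarrow> x r \<noteq> x s"
    and den: "\<And>r s k. r \<in> {1..n} \<Longrightarrow> s \<in> {1..n} \<Longrightarrow> qpoch q (q * x r / x s) k \<noteq> 0"
  shows "inner_sum q n \<alpha> b x f k = (\<Sum>m=0..msize n k. qpoch q (q powi (- int (msize n k))) m / qpoch q q m
      * qpoch q (\<alpha> * q ^ msize n k) m * q ^ m * (f (\<alpha> * q ^ (1 + m)) / qpoch q (\<alpha> * b) m))"
proof -
  have vq: "vdm n (\<lambda>r. x r * q ^ k r) / vdm n x = vandermonde_quot q n x k * q ^ (\<Sum>r=1..n. (r - 1) * k r)" for k
    by (rule vandermonde_quot_eq_vdm[OF q0 x0 xx, symmetric])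
  have milne: "(\<Sum>k\<in>level n j. mterm q n x c k) = qpoch q (vprod n c) j / qpoch q q j" for c j
    by (rule milne_fundamental[OF q0 q1 x0 xx den])
  define a where "a s = q powi (- int (k s))" for s
  define h where "h m = qpoch q (\<alpha> * q ^ msize n k) m * q ^ m * (f (\<alpha> * q ^ (1 + m)) / qpoch q (\<alpha> * b) m)" for m
  define S where "S = {m \<in> multi_indices n. msize n m \<le> msize n k}"
  have va: "vprod n a = q powi (- int (msize n k))"
  proof -
    have "vprod n a = (\<Prod>r=1..n. inverse (q ^ k r))"
      unfolding vprod_def a_def by (intro prod.cong refl) (simp add: power_int_minus)
    also have "\<dots> = inverse (q ^ msize n k)"
      unfolding msize_def power_sum by (simp only: prod_inversef[symmetric] o_def)
    finally show ?thesis by (simp only: power_int_minus power_int_of_nat)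
  qed
  have "inner_sum q n \<alpha> b x f k = (\<Sum>m\<in>multi_le n k. mterm q n x a m * h (msize n m))"
    unfolding inner_sum_def
  proof (intro sum.cong refl)
    fix m :: "nat \<Rightarrow> nat"
    have "(\<Sum>r=1..n. r * m r) = (\<Sum>r=1..n. (r - 1) * m r + m r)"
      by (intro sum.cong refl) (auto dest!: Suc_le_D)
    then have e: "q ^ (\<Sum>r=1..n. r * m r) = q ^ (\<Sum>r=1..n. (r - 1) * m r) * q ^ msize n m"
      by (simp only: sum.distrib power_add msize_def)
    have "mterm q n x a m = (vandermonde_quot q n x m * q ^ (\<Sum>r=1..n. (r - 1) * m r))
        * (\<Prod>r=1..n. \<Prod>s=1..n. qpoch q (q powi (- int (k s)) * x r / x s) (m r) / qpoch q (q * x r / x s) (m r))"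
      unfolding mterm_def vq a_def by simp
    then show "vandermonde_quot q n x m
        * (\<Prod>r=1..n. \<Prod>s=1..n. qpoch q (q powi (- int (k s)) * x r / x s) (m r) / qpoch q (q * x r / x s) (m r))
        * (qpoch q (\<alpha> * q ^ msize n k) (msize n m) / qpoch q (\<alpha> * b) (msize n m))
        * q ^ (\<Sum>r=1..n. r * m r) * f (\<alpha> * q ^ (1 + msize n m)) = mterm q n x a m * h (msize n m)"
      unfolding e h_def by (simp add: mult_ac)
  qed
  also have "\<dots> = (\<Sum>m\<in>S. mterm q n x a m * h (msize n m))"
  proof (rule sum.mono_neutral_left)
    show "finite S" unfolding S_def by (rule finite_msize_le)
    show "multi_le n k \<subseteq> S"
      by (auto simp: multi_le_def S_def multi_indices_def PiE_def msize_def intro!: sum_mono)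
    show "\<forall>m\<in>S - multi_le n k. mterm q n x a m * h (msize n m) = 0"
    proof
      fix m assume "m \<in> S - multi_le n k"
      then have "\<not> (\<forall>r\<in>{1..n}. m r \<le> k r)"
        by (auto simp: multi_le_def S_def multi_indices_def PiE_def Pi_def)
      then obtain r where r: "r \<in> {1..n}" "k r < m r"
        by (auto simp: not_le)
      have "qpoch q (a r) (m r) = 0"
        using qpoch_neg_power_eq_0[OF q0 r(2)] by (simp add: a_def)
      then show "mterm q n x a m * h (msize n m) = 0" by (simp add: mterm_eq_0[OF r(1), where x = x, OF x0[OF r(1)]])
    qed
  qed
  also have "\<dots> = (\<Sum>j=0..msize n k. \<Sum>m\<in>level n j. mterm q n x a m * h (msize n m))"
    unfolding S_def by (rule sum_msize_le)
  also have "\<dots> = (\<Sum>j=0..msize n k. (\<Sum>m\<in>level n j. mterm q n x a m) * h j)"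
    unfolding sum_distrib_right by (intro sum.cong refl) (simp add: level_def)
  also have "\<dots> = (\<Sum>j=0..msize n k. qpoch q (q powi (- int (msize n k))) j / qpoch q q j * h j)"
    unfolding milne va by (rule refl)
  finally show ?thesis by (simp only: h_def mult.assoc)
qed

lemma terminating_case:
  fixes q \<alpha> b :: complex and n :: nat and x a :: "nat \<Rightarrow> complex" and N :: "nat \<Rightarrow> nat"
  assumes q: "0 < norm q" "norm q < 1"
    and x0: "\<And>s. s \<in> {1..n} \<Longrightarrow> x s \<noteq> 0"
    and xx: "\<And>r s. r \<in> {1..n} \<Longrightarrow> s \<in> {1..n} \<Longrightarrow> r \<noteq> s \<Longrightarrow> x r \<noteq> x s"
    and den: "\<And>r s k. r \<in> {1..n} \<Longrightarrow> s \<in> {1..n} \<Longrightarrow> qpoch q (q * x r / x s) k \<noteq> 0"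
    and al: "1 - \<alpha> \<noteq> 0"
    and den1: "\<And>k. qpoch q (\<alpha> * vprod n a * q powi (1 - int n)) k \<noteq> 0"
    and den2: "\<And>k. qpoch q (\<alpha> * b) k \<noteq> 0"
    and N: "\<And>r. r \<in> {1..n} \<Longrightarrow> N r \<ge> 1 \<and> a r = q ^ N r"
  shows "(series_term q n \<alpha> b x f a has_sum lhs q n \<alpha> b f a) (multi_indices n)"
proof -
  have q0: "q \<noteq> 0" using q by auto
  have q1: "q ^ j \<noteq> 1" if "j > 0" for j
    using power_strict_mono[OF q(2), of j] that q by (metis norm_ge_zero norm_one norm_power order_less_irrefl power_one)
  have vq: "vdm n (\<lambda>r. x r * q ^ k r) / vdm n x = vandermonde_quot q n x k * q ^ (\<Sum>r=1..n. (r - 1) * k r)" for k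
    by (rule vandermonde_quot_eq_vdm[OF q0 x0 xx, symmetric])
  have milne: "(\<Sum>k\<in>level n j. mterm q n x c k) = qpoch q (vprod n c) j / qpoch q q j" for c j
    by (rule milne_fundamental[OF q0 q1 x0 xx den])
  define M where "M = (\<Sum>r=1..n. N r)"
  \<comment> \<open>Terms with some k_r > N r - 1 vanish, so \<open>L\<close> bounds |k| in the sum;
    moreover q^(1-n) a_1...a_n = q^(L+1).\<close>
  define L where "L = (\<Sum>r=1..n. N r - 1)"
  have M_eq: "M = L + n"
  proof -
    have "M = (\<Sum>r=1..n. (N r - 1) + 1)"
      unfolding M_def using N by (intro sum.cong refl) fastforce
    also have "\<dots> = L + n" unfolding L_def sum.distrib by simp
    finally show ?thesis .
  qed
  have va: "vprod n a = q ^ M"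
    unfolding vprod_def M_def power_sum using N by (intro prod.cong refl) auto
  have aq: "\<alpha> * vprod n a * q powi (1 - int n) = \<alpha> * q ^ Suc L"
    using q0 by (simp add: va M_eq power_int_diff power_add)
  have den1': "qpoch q (\<alpha> * q ^ Suc L) k \<noteq> 0" for k using den1[of k] by (simp only: aq) simp
  define a' where "a' s = q / a s" for s
  have va': "vprod n a' = q powi (- int L)"
  proof -
    have "vprod n a' = q ^ n / q ^ M" using va by (simp add: vprod_def a'_def prod_dividef)
    then show ?thesis using q0 by (simp add: M_eq power_add power_int_minus field_simps)
  qed
  have a0: "a s \<noteq> 0" if "s \<in> {1..n}" for s using N[OF that] q0 by simp
  define g where "g m = f (\<alpha> * q ^ (1 + m)) / qpoch q (\<alpha> * b) m" for m
  define I where "I k = (\<Sum>m=0..k. qpoch q (q powi (- int k)) m / qpoch q q m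
      * qpoch q (\<alpha> * q ^ k) m * q ^ m * g m)" for k
  define H where "H k = ((1 - \<alpha> * q ^ (2 * k)) * qpoch q \<alpha> k
        / ((1 - \<alpha>) * qpoch q (\<alpha> * q ^ Suc L) k)) * q ^ (L * k) * I k" for k
  \<comment> \<open>Apart from \<open>mterm\<close>, the term depends on |k| alone. The power
    q^(M|k|) from \<open>numer\<close> loses q^(n|k|) and leaves the q^(L|k|) of the
    inversion.\<close>
  have st: "series_term q n \<alpha> b x f a k = mterm q n x a' k * H (msize n k)" for k
  proof -
    have I: "inner_sum q n \<alpha> b x f k = I (msize n k)"
      unfolding I_def g_def by (rule inner_sum_eq[OF q0 q1 x0 xx den])
    define P where "P = (\<Prod>r=1..n. \<Prod>s=1..n. qpoch q (a' s * x r / x s) (k r))"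
    define D where "D = (\<Prod>r=1..n. \<Prod>s=1..n. qpoch q (q * x r / x s) (k r))"
    have nu: "numer q n x k a = P * q ^ (M * msize n k)"
    proof -
      have "numer q n x k a = numer_generic q n x k a" using a0 by (simp add: numer_def)
      also have "\<dots> = P * vprod n a ^ msize n k"
        unfolding numer_generic_def P_def a'_def by (simp add: mult_ac)
      finally show ?thesis by (simp add: va power_mult)
    qed
    have mt: "mterm q n x a' k = (vandermonde_quot q n x k * q ^ (\<Sum>r=1..n. (r - 1) * k r)) * (P / D)"
      unfolding mterm_def vq P_def D_def prod_dividef by simp
    have "(\<Sum>r=1..n. (int r - 1) * int (k r)) = (\<Sum>r=1..n. int ((r - 1) * k r))"
      by (intro sum.cong refl) simp
    then have e: "(\<Sum>r=1..n. (int r - 1) * int (k r)) - int n * int (msize n k)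
        = int (\<Sum>r=1..n. (r - 1) * k r) - int (n * msize n k)" by simp
    have pw: "q powi ((\<Sum>r=1..n. (int r - 1) * int (k r)) - int n * int (msize n k))
        = q ^ (\<Sum>r=1..n. (r - 1) * k r) / q ^ (n * msize n k)"
      unfolding e by (simp only: power_int_diff power_int_of_nat q0 simp_thms)
    have qm: "q ^ (M * msize n k) / q ^ (n * msize n k) = q ^ (L * msize n k)"
      using q0 by (simp add: M_eq add_mult_distrib power_add)
    show ?thesis
      unfolding series_term_def I nu pw aq mt H_def qm[symmetric] D_def[symmetric]
      by (simp add: mult_ac)
  qed
  define S where "S = {k \<in> multi_indices n. msize n k \<le> L}"
  have zero: "series_term q n \<alpha> b x f a k = 0" if k: "k \<in> multi_indices n - S" for k
  proof -
    have "L < msize n k" using k by (auto simp: S_def)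
    then have "\<not> (\<forall>r\<in>{1..n}. k r \<le> N r - 1)"
      unfolding L_def msize_def by (meson leD sum_mono)
    then obtain r where r: "r \<in> {1..n}" "N r - 1 < k r" by fastforce
    have "a' r = q powi (- int (N r - 1))"
      using N[OF r(1)] q0 by (simp add: a'_def power_int_diff)
    then have "qpoch q (a' r) (k r) = 0"
      using qpoch_neg_power_eq_0[OF q0 r(2)] by simp
    then show ?thesis by (simp add: st mterm_eq_0[OF r(1), where x = x, OF x0[OF r(1)]])
  qed
  have "(\<Sum>k\<in>S. series_term q n \<alpha> b x f a k) = (\<Sum>j=0..L. \<Sum>k\<in>level n j. mterm q n x a' k * H (msize n k))"
    unfolding S_def sum_msize_le st by (rule refl)
  also have "\<dots> = (\<Sum>j=0..L. (\<Sum>k\<in>level n j. mterm q n x a' k) * H j)"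
    unfolding sum_distrib_right by (intro sum.cong refl) (simp add: level_def)
  also have "\<dots> = (\<Sum>j=0..L. qpoch q (q powi (- int L)) j / qpoch q q j * H j)"
    unfolding milne va' by (rule refl)
  also have "\<dots> = qpoch q (\<alpha> * q) L * g L"
    unfolding H_def I_def mult.assoc[symmetric] by (rule bailey_inversion[OF q0 q1 al den1', unfolded mult.assoc[symmetric]])
  also have "\<dots> = lhs q n \<alpha> b f a"
  proof -
    have b1: "\<alpha> * vprod n a * b / q ^ n = \<alpha> * b * q ^ L"
      using q0 by (simp add: va M_eq power_add)
    \<comment> \<open>Cutting both infinite products after L factors makes the tails cancel and
      leaves (\<alpha> q)_L / (\<alpha> b)_L.\<close>
    have s1: "qpoch_inf q (\<alpha> * q) = qpoch q (\<alpha> * q) L * qpoch_inf q (\<alpha> * q ^ Suc L)"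
      using qpoch_inf_split[OF q(2), of "\<alpha> * q" L] by (simp add: mult.assoc)
    have s2: "qpoch_inf q (\<alpha> * b) = qpoch q (\<alpha> * b) L * qpoch_inf q (\<alpha> * b * q ^ L)"
      by (rule qpoch_inf_split[OF q(2)])
    have z1: "qpoch_inf q (\<alpha> * q ^ Suc L) \<noteq> 0" by (rule qpoch_inf_nonzero[OF q(2) den1'])
    have z2: "qpoch_inf q (\<alpha> * b * q ^ L) \<noteq> 0" "qpoch q (\<alpha> * b) L \<noteq> 0"
      using qpoch_inf_nonzero[OF q(2) den2] unfolding s2 by auto
    show ?thesis
      unfolding lhs_def aq b1 s1 s2 g_def using z1 z2 by simp
  qed
  finally have "(series_term q n \<alpha> b x f a has_sum lhs q n \<alpha> b f a) S"
    using finite_msize_le by (intro has_sum_finiteI) (auto simp: S_def)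
  then show ?thesis
    using zero by (subst has_sum_cong_neutral[where T = S and g = "series_term q n \<alpha> b x f a"]) (auto simp: S_def)
qed

section \<open>Analytic continuation from powers of q\<close>

text \<open>The expansion is taken around \<open>p(j := w)\<close>, for arbitrary w in the disk.
  Along the j-th direction only multi-indices supported at j contribute, so the n-fold series
  becomes an ordinary power series in z - w.\<close>

lemma multi_analytic_on_imp_holomorphic_coordinate:
  assumes F: "multi_analytic_on n F (polydisk n R)" and p: "p \<in> polydisk n R" and j: "j \<in> {1..n}"
  shows "(\<lambda>z. F (p(j := z))) holomorphic_on ball 0 R"
proof -
  have "(\<lambda>z. F (p(j := z))) field_differentiable at w" if w: "w \<in> ball 0 R" for w
  proof -
    have "p(j := w) \<in> polydisk n R" using p w by (auto simp: polydisk_def)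
    then obtain e c where e: "e > 0"
      and has: "\<And>a. \<forall>r\<in>{1..n}. norm (a r - (p(j := w)) r) < e \<Longrightarrow>
        ((\<lambda>k. c k * (\<Prod>r=1..n. (a r - (p(j := w)) r) ^ k r)) has_sum F a) (multi_indices n)"
      using F unfolding multi_analytic_on_def by blast
    define \<iota> where "\<iota> m = (\<lambda>r\<in>{1..n}. if r = j then m else 0)" for m :: nat
    define T where "T = {k \<in> multi_indices n. \<forall>r\<in>{1..n}-{j}. k r = 0}"
    have bij: "bij_betw \<iota> UNIV T"
    proof (rule bij_betwI[where g = "\<lambda>k. k j"])
      show "\<iota> \<in> UNIV \<rightarrow> T" by (auto simp: \<iota>_def T_def multi_indices_def)
      fix k assume "k \<in> T"
      then show "\<iota> (k j) = k"
        by (auto simp: \<iota>_def T_def multi_indices_def fun_eq_iff PiE_def extensional_def)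
    qed (use j in \<open>auto simp: \<iota>_def\<close>)
    have "(\<lambda>m. c (\<iota> m) * (z - w) ^ m) sums F (p(j := z))" if z: "z \<in> ball w e" for z
    proof -
      define P where "P k = (\<Prod>r=1..n. ((p(j := z)) r - (p(j := w)) r) ^ k r)" for k
      \<comment> \<open>As 0 ^ 0 = 1, the second product is 1 on \<open>T\<close> and 0
        elsewhere.\<close>
      have P: "P k = (z - w) ^ k j * (\<Prod>r\<in>{1..n}-{j}. 0 ^ k r)" for k
        unfolding P_def using j by (subst prod.remove[of _ j]) (auto intro!: prod.cong)
      have "\<forall>r\<in>{1..n}. norm ((p(j := z)) r - (p(j := w)) r) < e"
        using z e by (auto simp: dist_norm norm_minus_commute)
      from has[OF this] have "((\<lambda>k. c k * P k) has_sum F (p(j := z))) (multi_indices n)"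
        by (simp only: P_def)
      then have "((\<lambda>k. c k * P k) has_sum F (p(j := z))) T"
      proof (subst has_sum_cong_neutral[where T = "multi_indices n" and g = "\<lambda>k. c k * P k"])
        fix k assume "k \<in> multi_indices n - T"
        then obtain r where r: "r \<in> {1..n} - {j}" "k r \<noteq> 0" unfolding T_def by blast
        then have "(0::complex) ^ k r = 0" by simp
        with r(1) have "(\<Prod>r\<in>{1..n}-{j}. (0::complex) ^ k r) = 0"
          by (intro prod_zero) (simp, blast)
        then show "c k * P k = 0" by (simp add: P)
      qed (auto simp: T_def)
      then have "((\<lambda>m. c (\<iota> m) * P (\<iota> m)) has_sum F (p(j := z))) UNIV"
        by (subst has_sum_reindex_bij_betw[OF bij])
      moreover have "P (\<iota> m) = (z - w) ^ m" for m
        unfolding P using j by (simp add: \<iota>_def)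
      ultimately show ?thesis using has_sum_imp_sums by simp
    qed
    then have "(\<lambda>z. F (p(j := z))) holomorphic_on ball w e"
      by (rule power_series_holomorphic)
    then show ?thesis
      using e by (intro holomorphic_on_imp_differentiable_at) auto
  qed
  then show ?thesis
    by (auto simp: holomorphic_on_def intro: field_differentiable_at_within)
qed

lemma zero_islimpt_powers:
  fixes q :: complex
  assumes "0 < norm q" "norm q < 1" "0 < R"
  shows "0 islimpt {q ^ m |m. m \<ge> N \<and> norm (q ^ m) < R}"
  unfolding islimpt_approachable
proof (intro allI impI)
  fix e :: real assume "e > 0"
  have "(\<lambda>m. norm q ^ m) \<longlonglongrightarrow> 0" using assms by (intro LIMSEQ_realpow_zero) auto
  then have "\<forall>\<^sub>F m in sequentially. norm q ^ m < min e R"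
    using \<open>e > 0\<close> assms(3) by (intro order_tendstoD) auto
  moreover have "\<forall>\<^sub>F m in sequentially. m \<ge> N" by (rule eventually_ge_at_top)
  ultimately have "\<forall>\<^sub>F m in sequentially. norm q ^ m < min e R \<and> m \<ge> N" by eventually_elim auto
  then obtain m where "norm q ^ m < min e R" "m \<ge> N"
    using eventually_happens' sequentially_bot by blast
  then show "\<exists>x'\<in>{q ^ m |m. m \<ge> N \<and> norm (q ^ m) < R}. x' \<noteq> 0 \<and> dist x' 0 < e"
    using assms(1) by (intro bexI[of _ "q ^ m"]) (auto simp: norm_power)
qed

text \<open>The one-variable identity theorem is applied to one coordinate after the other.\<close>

lemma multi_analytic_eq_from_powers:
  fixes q :: complex
  assumes q: "0 < norm q" "norm q < 1" and R: "0 < R"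
    and F: "multi_analytic_on n F (polydisk n R)" and G: "multi_analytic_on n G (polydisk n R)"
    and eq: "\<And>a. a \<in> polydisk n R \<Longrightarrow> \<forall>r\<in>{1..n}. \<exists>m\<ge>N. a r = q ^ m \<Longrightarrow> F a = G a"
    and a: "a \<in> polydisk n R"
  shows "F a = G a"
proof -
  \<comment> \<open>Coordinates up to j are free, the later ones are powers of q; each induction
    step frees one more, and j = n is the claim.\<close>
  have "F a = G a" if "j \<le> n" "a \<in> polydisk n R" "\<forall>r\<in>{1..n}. r > j \<longrightarrow> (\<exists>m\<ge>N. a r = q ^ m)" for j a
    using that
  proof (induction j arbitrary: a)
    case 0
    then show ?case by (intro eq) auto
  next
    case (Suc j)
    define U where "U = {q ^ m |m. m \<ge> N \<and> norm (q ^ m) < R}"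
    have j: "Suc j \<in> {1..n}" using Suc.prems by auto
    define h where "h z = F (a(Suc j := z)) - G (a(Suc j := z))" for z
    have hol: "h holomorphic_on ball 0 R"
      unfolding h_def using multi_analytic_on_imp_holomorphic_coordinate[OF F Suc.prems(2) j]
        multi_analytic_on_imp_holomorphic_coordinate[OF G Suc.prems(2) j]
      by (rule holomorphic_on_diff)
    have "h (a (Suc j)) = 0"
    \<comment> \<open>The zeros of \<open>h\<close> in \<open>U\<close> accumulate at 0, an interior
      point of the disk, so \<open>h\<close> vanishes on the whole disk.\<close>
    proof (rule analytic_continuation[OF hol, of U 0])
      show "0 islimpt U" unfolding U_def by (rule zero_islimpt_powers[OF q R])
      show "a (Suc j) \<in> ball 0 R" using Suc.prems(2) j by (auto simp: polydisk_def)
      fix z assume z: "z \<in> U"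
      then have zR: "norm z < R" and zm: "\<exists>m\<ge>N. z = q ^ m" by (auto simp: U_def)
      have "F (a(Suc j := z)) = G (a(Suc j := z))"
      proof (rule Suc.IH)
        show "a(Suc j := z) \<in> polydisk n R" using Suc.prems(2) zR by (auto simp: polydisk_def)
        show "\<forall>r\<in>{1..n}. j < r \<longrightarrow> (\<exists>m\<ge>N. (a(Suc j := z)) r = q ^ m)"
          using Suc.prems(3) zm by (auto simp: less_Suc_eq)
      qed (use Suc.prems(1) in simp)
      then show "h z = 0" by (simp add: h_def)
    qed (use R in \<open>auto simp: U_def\<close>)
    then show ?case by (simp add: h_def)
  qed
  from this[of n a] show ?thesis using a by auto
qed

theorem theorem1p3:
  fixes q \<alpha> b :: complex and n :: nat and x a :: "nat \<Rightarrow> complex"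
    and f :: "complex \<Rightarrow> complex"
  assumes "0 < norm q" and "norm q < 1" and "n \<ge> 1"
    and "\<And>s. s \<in> {1..n} \<Longrightarrow> x s \<noteq> 0"
    and "\<And>r s. 1 \<le> r \<Longrightarrow> r < s \<Longrightarrow> s \<le> n \<Longrightarrow> 1 - x r / x s \<noteq> 0"
    and "\<And>r s k. r \<in> {1..n} \<Longrightarrow> s \<in> {1..n} \<Longrightarrow> qpoch q (q * x r / x s) k \<noteq> 0"
    and "1 - \<alpha> \<noteq> 0"
    and "\<And>k. qpoch q (\<alpha> * vprod n a * q powi (1 - int n)) k \<noteq> 0"
    and "\<And>k. qpoch q (\<alpha> * b) k \<noteq> 0"
    and "qpoch_inf q (\<alpha> * vprod n a * q powi (1 - int n)) \<noteq> 0"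
    and "qpoch_inf q (\<alpha> * b) \<noteq> 0"
    and "(\<exists>R::real. 0 < R \<and>
            multi_analytic_on n (lhs q n \<alpha> b f) (polydisk n R) \<and>
            multi_analytic_on n
              (\<lambda>a'. \<Sum>\<^sub>\<infinity>k\<in>multi_indices n. series_term q n \<alpha> b x f a' k) (polydisk n R) \<and>
            (\<forall>a'\<in>polydisk n R. (\<lambda>k. norm (series_term q n \<alpha> b x f a' k)) summable_on multi_indices n) \<and>
            a \<in> polydisk n R)
         \<or> (\<exists>N :: nat \<Rightarrow> nat. \<forall>r\<in>{1..n}. N r \<ge> 1 \<and> a r = q ^ N r)"
  shows "(series_term q n \<alpha> b x f a has_sum lhs q n \<alpha> b f a) (multi_indices n)"
proof -
  let ?rhs = "\<lambda>a'. \<Sum>\<^sub>\<infinity>k\<in>multi_indices n. series_term q n \<alpha> b x f a' k"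
  note q = assms(1,2) and x0 = assms(4) and den = assms(6) and al = assms(7)
  have xx: "x r \<noteq> x s" if "r \<in> {1..n}" "s \<in> {1..n}" "r \<noteq> s" for r s
  proof -
    have "x r \<noteq> x s" if "1 \<le> r" "r < s" "s \<le> n" for r s
      using assms(5)[OF that] x0[of s] that by auto
    from this[of r s] this[of s r] show ?thesis
      using that by (metis atLeastAtMost_iff linorder_neqE_nat)
  qed
  show ?thesis
    using assms(12)
  proof
    assume "\<exists>N. \<forall>r\<in>{1..n}. N r \<ge> 1 \<and> a r = q ^ N r"
    then obtain N where N: "\<And>r. r \<in> {1..n} \<Longrightarrow> N r \<ge> 1 \<and> a r = q ^ N r" by blast
    show ?thesis
      by (rule terminating_case[OF q x0 xx den al assms(8) assms(9) N])
  next
    assume "\<exists>R>0. multi_analytic_on n (lhs q n \<alpha> b f) (polydisk n R)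
      \<and> multi_analytic_on n ?rhs (polydisk n R)
      \<and> (\<forall>a'\<in>polydisk n R. (\<lambda>k. norm (series_term q n \<alpha> b x f a' k)) summable_on multi_indices n)
      \<and> a \<in> polydisk n R"
    then obtain R where R: "0 < R" and L: "multi_analytic_on n (lhs q n \<alpha> b f) (polydisk n R)"
      and S: "multi_analytic_on n ?rhs (polydisk n R)"
      and sm: "(\<lambda>k. norm (series_term q n \<alpha> b x f a k)) summable_on multi_indices n"
      and a: "a \<in> polydisk n R"
      by blast
    have "(\<lambda>m. norm \<alpha> * norm q ^ m) \<longlonglongrightarrow> norm \<alpha> * 0"
      using q by (intro tendsto_intros LIMSEQ_realpow_zero) auto
    then have "\<forall>\<^sub>F m in sequentially. norm \<alpha> * norm q ^ m < 1"
      by (intro order_tendstoD) auto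
    then obtain N0 where N0: "\<And>m. m \<ge> N0 \<Longrightarrow> norm \<alpha> * norm q ^ m < 1"
      by (auto simp: eventually_sequentially)
    \<comment> \<open>Large exponents keep the denominators nonzero even when \<open>\<alpha> = q\<^bsup>-j\<^esup>\<close> for some \<open>j\<close>.\<close>
    have "lhs q n \<alpha> b f a = ?rhs a"
    proof (rule multi_analytic_eq_from_powers[OF q R L S _ a])
      fix a' assume "\<forall>r\<in>{1..n}. \<exists>m\<ge>Suc N0. a' r = q ^ m"
      then obtain N where N: "\<And>r. r \<in> {1..n} \<Longrightarrow> N r \<ge> Suc N0 \<and> a' r = q ^ N r" by metis
      define M where "M = (\<Sum>r=1..n. N r)"
      have va: "vprod n a' = q ^ M"
        unfolding vprod_def M_def power_sum using N by (intro prod.cong refl) auto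
      have "n * Suc N0 \<le> M"
        unfolding M_def using sum_bounded_below[of "{1..n}" "Suc N0" N] N by simp
      \<comment> \<open>All exponents are at least N0 + 1 and n is positive, so dividing q^M by q^n
        still leaves an exponent d \<ge> N0. Every \<alpha> q^(d+1+i) then has norm below 1.\<close>
      moreover have "n + N0 \<le> n * Suc N0" using assms(3) by (cases n) auto
      ultimately obtain d where d: "M = n + d" "N0 \<le> d"
        by (metis add_le_imp_le_left le_add1 le_trans less_eqE)
      have aq: "\<alpha> * vprod n a' * q powi (1 - int n) = \<alpha> * q ^ Suc d"
        using q by (simp add: va d power_int_diff power_add)
      have dn: "qpoch q (\<alpha> * vprod n a' * q powi (1 - int n)) k \<noteq> 0" for k
      proof -
        have "\<alpha> * q ^ Suc d * q ^ i \<noteq> 1" for i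
        proof
          assume "\<alpha> * q ^ Suc d * q ^ i = 1"
          then have "norm (\<alpha> * q ^ (Suc d + i)) = 1" by (simp add: power_add mult.assoc)
          with N0[of "Suc d + i"] d(2) show False by (simp add: norm_mult norm_power)
        qed
        then show ?thesis unfolding aq qpoch_def by (subst prod_zero_iff) auto
      qed
      have "(series_term q n \<alpha> b x f a' has_sum lhs q n \<alpha> b f a') (multi_indices n)"
      proof (rule terminating_case[OF q x0 xx den al dn assms(9)])
        fix r assume "r \<in> {1..n}"
        from N[OF this] show "N r \<ge> 1 \<and> a' r = q ^ N r" by auto
      qed
      then show "lhs q n \<alpha> b f a' = ?rhs a'" by (simp add: infsumI)
    qed
    \<comment> \<open>The equation for the infinite sum does not itself assert convergence, as
      \<open>infsum\<close> has a default value; summability at \<open>a\<close> upgrades it to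
      \<open>has_sum\<close>.\<close>
    moreover have "series_term q n \<alpha> b x f a summable_on multi_indices n"
      using sm by (rule abs_summable_summable)
    ultimately show ?thesis by simp
  qed
qed

end
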